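(* Let $(A,B)$ be a Katsura pair, let $(\widehat G_B,E_A)$ be the associated KEP-groupoid, and let $K$ be any field. The singular ideal $\widehat J_K$ of the Steinberg algebra $K\mathcal G_{(\widehat G_B,E_A)}$ is non-zero if and only if there exists a vertex $v\in E_A^0$ such that $(\widehat G_B)_v$ acts non-faithfully on $vE_A^*$ and both of the following hold: (T1) there exist a simple path $r\in vE_A^*$ and a simple cycle $c\in \mathbf s(r)E_A^*\mathbf s(r)$ with $B_{rc}\neq 0$; (T2) for all $p\in vE_A^*$ there exists some $q\in \mathbf s(p)E_A^*$ such that $B_{pq}=0$.
   Context: Katsura pairs and graphs. Let $N\ge 1$. A Katsura pair $(A,B)$ consists of $N\times N$ integer matrices such that $A$ has nonnegative entries and no zero row, and $A_{u,v}=0$ implies $B_{u,v}=0$. The finite directed graph $E_A$ has vertex set $E_A^0=\{1,\dots,N\}$ and edges $E_A^1=\{e_{u,v,r}: 0\le r<A_{u,v}\}$, where $e_{u,v,r}$ has range $\mathbf r(e_{u,v,r})=u$ and source $\mathbf s(e_{u,v,r})=v$. A path $p=e_1\cdots e_n$ satisfies $\mathbf s(e_i)=\mathbf r(e_{i+1})$; $\mathbf r(p)=\mathbf r(e_1)$, $\mathbf s(p)=\mathbf s(e_n)$; vertices are the paths of length $0$. $E_A^*$ is the set of finite paths, $E_A^\omega$ the set of infinite paths $e_1e_2\cdots$; $pE_A^*$, $pE_A^\omega$ are the paths with prefix $p$ (so $vE_A^*$ is the set of finite paths with range $v$), and $uE_A^*w$ is the set of finite paths with range $u$ and source $w$. Writing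 $pq$ presupposes $\mathbf s(p)=\mathbf r(q)$. A cycle is a path of positive length with equal range and source; a simple path is a path containing no cycle as a subsequence of edges (vertices are simple paths); a simple cycle is a cycle containing no cycle as a proper subsequence of edges. For $p=e_1\cdots e_n$ put $A_p=\prod_l A_{\mathbf r(e_l),\mathbf s(e_l)}$, $B_p=\prod_l B_{\mathbf r(e_l),\mathbf s(e_l)}$, and $A_v=B_v=1$ for vertices $v$. KEP-groupoid. $\widehat G_B$ is the disjoint union over $v\in E_A^0$ of infinite cyclic groups $(\widehat G_B)_v=\langle g_v\rangle$, a groupoid (group bundle) with unit space $E_A^0$, the identity of $(\widehat G_B)_v$ being $v$. For $k\in\mathbb Z$ and $e_{u,v,r}\in E_A^1$, let $\hat k\in\mathbb Z$, $0\le\hat r<A_{u,v}$ be unique with $kB_{u,v}+r=\hat kA_{u,v}+\hat r$; put $g_u^k(e_{u,v,r})=e_{u,v,\hat r}$ and section $g_u^k|_{e_{u,v,r}}=g_v^{\hat k}$. This extends to paths by $g(ep)=g(e)\,g|_e(p)$, $g|_{ep}=(g|_e)|_p$, giving an action of $(\widehat G_B)_v$ on $vE_A^*$ and on $vE_A^\omega$. Write $(G,E)=(\widehat G_B,E_A)$. Inverse semigroup and ample groupoid. $S=S_{(G,E)}$ is the inverse semigroup with zero generated by $E^0\cup E^1\cup\{e^*:e\in E^1\}\cup G\cup\{0\}$, with the multiplication of $G$ (undefined products being $0$; $g^*=g^{-1}$, $v^*=v$) and relations $e\,\mathbf s(e)=\mathbf r(e)e=e$ and correspondingly for $e^*$;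 $uv=0$ for distinct vertices; $e^*f=0$ for distinct edges; $e^*e=\mathbf s(e)$; $ge=g(e)\,g|_e$. Its nonzero elements are uniquely of the form $pgq^*$ with $p,q\in E^*$, $\mathbf s(p)=\mathbf s(q)$, $g\in (G)_{\mathbf s(p)}$. It acts by partial bijections $pgq^*:qE^\omega\to pE^\omega$, $qw\mapsto p\,g(w)$. The ample groupoid $\mathcal G_{(G,E)}$ has unit space $E^\omega$ (topology generated by the sets $pE^\omega$, $p\in E^*$) and consists of germs $[s,w]$, where $s=pgq^*\in S\setminus\{0\}$, $w\in qE^\omega$, and $[s,w]=[t,z]$ iff $w=z$ and $sx=tx$ in $S$ for some finite prefix $x$ of $w$; $[s,t(w)][t,w]=[st,w]$, $[s,w]^{-1}=[s^*,s(w)]$, source $w$, range $s(w)$; the topology is the quotient of the topology on the pairs $(s,w)$ with $S$ discrete. Steinberg algebra. $K\mathcal G$ is the $K$-algebra, under convolution, spanned by indicator functions of compact open bisections of $\mathcal G$. Its singular ideal is $\{f\in K\mathcal G: \{\gamma: f(\gamma)\neq0\}\text{ has empty interior}\}$, denoted $\widehat J_K$ for $\mathcal G=\mathcal G_{(\widehat G_B,E_A)}$. *)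

theory Defs
  imports
    "HOL-Analysis.Analysis"
    "HOL-Algebra.Module"
    "HOL-Library.Sublist"
    "HOL-Library.Omega_Words_Fun"
begin

section \<open>Katsura pairs and their graphs\<close>

text \<open>The index set of the square matrices is an arbitrary finite (nonempty) type \<open>'n\<close>, which is
  also the vertex set of the graph.\<close>

definition katsura_pair :: "int^'n^'n \<Rightarrow> int^'n^'n \<Rightarrow> bool" where
  "katsura_pair A B \<longleftrightarrow>
     (\<forall>u v. 0 \<le> A $ u $ v) \<and> (\<forall>u. \<exists>v. A $ u $ v \<noteq> 0) \<and>
     (\<forall>u v. A $ u $ v = 0 \<longrightarrow> B $ u $ v = 0)"

datatype 'n edge = Edge (erange: 'n) (esource: 'n) (eindex: int)

definition edges :: "int^'n^'n \<Rightarrow> 'n edge set" where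
  "edges A = {e. 0 \<le> eindex e \<and> eindex e < A $ erange e $ esource e}"

text \<open>A finite path carries its range explicitly, so that \<open>FPath v []\<close> is the vertex \<open>v\<close>.\<close>

datatype 'n fpath = FPath (prange: 'n) (pedges: "'n edge list")

definition psource :: "'n fpath \<Rightarrow> 'n" where
  "psource p = (if pedges p = [] then prange p else esource (last (pedges p)))"

definition fpaths :: "int^'n^'n \<Rightarrow> 'n fpath set" where
  "fpaths A = {p. set (pedges p) \<subseteq> edges A \<and>
     (pedges p \<noteq> [] \<longrightarrow> erange (hd (pedges p)) = prange p) \<and>
     (\<forall>i. Suc i < length (pedges p) \<longrightarrow> esource (pedges p ! i) = erange (pedges p ! Suc i))}"

definition fpaths_from :: "int^'n^'n \<Rightarrow> 'n \<Rightarrow> 'n fpath set" where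
  "fpaths_from A v = {p \<in> fpaths A. prange p = v}"

definition papp :: "'n fpath \<Rightarrow> 'n fpath \<Rightarrow> 'n fpath" where
  "papp p q = FPath (prange p) (pedges p @ pedges q)"

definition ipaths :: "int^'n^'n \<Rightarrow> 'n edge word set" where
  "ipaths A = {w. \<forall>i. w i \<in> edges A \<and> esource (w i) = erange (w (Suc i))}"

definition cylinder :: "int^'n^'n \<Rightarrow> 'n fpath \<Rightarrow> 'n edge word set" where
  "cylinder A p = {pedges p \<frown> y | y.
     pedges p \<frown> y \<in> ipaths A \<and> y \<in> ipaths A \<and> erange (y 0) = psource p}"

definition ipath_topology :: "int^'n^'n \<Rightarrow> 'n edge word topology" where
  "ipath_topology A = topology_generated_by (cylinder A ` fpaths A)"

definition is_cycle :: "int^'n^'n \<Rightarrow> 'n fpath \<Rightarrow> bool" where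
  "is_cycle A c \<longleftrightarrow> c \<in> fpaths A \<and> pedges c \<noteq> [] \<and> prange c = psource c"

definition simple_fpath :: "int^'n^'n \<Rightarrow> 'n fpath \<Rightarrow> bool" where
  "simple_fpath A p \<longleftrightarrow>
     p \<in> fpaths A \<and> \<not> (\<exists>c. is_cycle A c \<and> subseq (pedges c) (pedges p))"

definition simple_cycle :: "int^'n^'n \<Rightarrow> 'n fpath \<Rightarrow> bool" where
  "simple_cycle A c \<longleftrightarrow>
     is_cycle A c \<and> \<not> (\<exists>d. is_cycle A d \<and> strict_subseq (pedges d) (pedges c))"

definition path_weight :: "int^'n^'n \<Rightarrow> 'n fpath \<Rightarrow> int" where
  "path_weight M p = (\<Prod>e\<leftarrow>pedges p. M $ erange e $ esource e)"


section \<open>The self-similar action of the group bundle\<close>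

text \<open>The element \<open>g\<^sub>v\<^sup>k\<close> is given by the vertex \<open>v\<close> and the exponent \<open>k\<close>. Below, the vertex is always
  the range of the edge or path acted upon, so only \<open>k\<close> is passed. The section of
  \<open>g\<^sub>u\<^sup>k\<close> at an edge \<open>e\<close> is the power of the generator at the source of \<open>e\<close> with exponent
  \<open>edge_section A B k e\<close>.\<close>

definition edge_act :: "int^'n^'n \<Rightarrow> int^'n^'n \<Rightarrow> int \<Rightarrow> 'n edge \<Rightarrow> 'n edge" where
  "edge_act A B k e = Edge (erange e) (esource e)
     ((k * B $ erange e $ esource e + eindex e) mod (A $ erange e $ esource e))"

definition edge_section :: "int^'n^'n \<Rightarrow> int^'n^'n \<Rightarrow> int \<Rightarrow> 'n edge \<Rightarrow> int" where
  "edge_section A B k e =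
     (k * B $ erange e $ esource e + eindex e) div (A $ erange e $ esource e)"

fun edges_act :: "int^'n^'n \<Rightarrow> int^'n^'n \<Rightarrow> int \<Rightarrow> 'n edge list \<Rightarrow> 'n edge list" where
  "edges_act A B k [] = []"
| "edges_act A B k (e # es) = edge_act A B k e # edges_act A B (edge_section A B k e) es"

definition fpath_act :: "int^'n^'n \<Rightarrow> int^'n^'n \<Rightarrow> int \<Rightarrow> 'n fpath \<Rightarrow> 'n fpath" where
  "fpath_act A B k p = FPath (prange p) (edges_act A B k (pedges p))"

primrec ipath_section :: "int^'n^'n \<Rightarrow> int^'n^'n \<Rightarrow> int \<Rightarrow> 'n edge word \<Rightarrow> nat \<Rightarrow> int" where
  "ipath_section A B k w 0 = k"
| "ipath_section A B k w (Suc i) = edge_section A B (ipath_section A B k w i) (w i)"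

definition ipath_act :: "int^'n^'n \<Rightarrow> int^'n^'n \<Rightarrow> int \<Rightarrow> 'n edge word \<Rightarrow> 'n edge word" where
  "ipath_act A B k w = (\<lambda>i. edge_act A B (ipath_section A B k w i) (w i))"

definition acts_faithfully :: "int^'n^'n \<Rightarrow> int^'n^'n \<Rightarrow> 'n \<Rightarrow> bool" where
  "acts_faithfully A B v \<longleftrightarrow>
     (\<forall>k. (\<forall>p \<in> fpaths_from A v. fpath_act A B k p = p) \<longrightarrow> k = 0)"


section \<open>The inverse semigroup\<close>

text \<open>The inverse semigroup with zero is given by its presentation: nonempty words in the generators
  modulo the least congruence containing the identities of inverse semigroups and of a zero together
  with the defining relations. A vertex is identified with the unit of the group at that vertex.\<close>

datatype 'n gen = Zero | Edg "'n edge" | EdgStar "'n edge" | Grp 'n int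

abbreviation Vtx :: "'n \<Rightarrow> 'n gen" where
  "Vtx v \<equiv> Grp v 0"

fun gen_star :: "'n gen \<Rightarrow> 'n gen" where
  "gen_star Zero = Zero"
| "gen_star (Edg e) = EdgStar e"
| "gen_star (EdgStar e) = Edg e"
| "gen_star (Grp v k) = Grp v (- k)"

definition word_star :: "'n gen list \<Rightarrow> 'n gen list" where
  "word_star x = rev (map gen_star x)"

definition gens :: "int^'n^'n \<Rightarrow> 'n gen set" where
  "gens A = {Zero} \<union> Edg ` edges A \<union> EdgStar ` edges A \<union> {Grp v k | v k. True}"

definition gen_words :: "int^'n^'n \<Rightarrow> 'n gen list set" where
  "gen_words A = lists (gens A) - {[]}"

inductive S_rel :: "int^'n^'n \<Rightarrow> int^'n^'n \<Rightarrow> 'n gen list \<Rightarrow> 'n gen list \<Rightarrow> bool"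
  for A B :: "int^'n^'n" where
  refl: "x \<in> gen_words A \<Longrightarrow> S_rel A B x x"
| sym: "S_rel A B x y \<Longrightarrow> S_rel A B y x"
| trans: "S_rel A B x y \<Longrightarrow> S_rel A B y z \<Longrightarrow> S_rel A B x z"
| mult: "S_rel A B x x' \<Longrightarrow> S_rel A B y y' \<Longrightarrow> S_rel A B (x @ y) (x' @ y')"
| inverse: "x \<in> gen_words A \<Longrightarrow> S_rel A B (x @ word_star x @ x) x"
| idem_commute: "x \<in> gen_words A \<Longrightarrow> y \<in> gen_words A \<Longrightarrow>
    S_rel A B (x @ word_star x @ y @ word_star y) (y @ word_star y @ x @ word_star x)"
| zero_left: "x \<in> gen_words A \<Longrightarrow> S_rel A B (Zero # x) [Zero]"
| zero_right: "x \<in> gen_words A \<Longrightarrow> S_rel A B (x @ [Zero]) [Zero]"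
| group_mult: "S_rel A B [Grp v k, Grp v l] [Grp v (k + l)]"
| group_undefined: "u \<noteq> v \<Longrightarrow> S_rel A B [Grp u k, Grp v l] [Zero]"
| edge_source: "e \<in> edges A \<Longrightarrow> S_rel A B [Edg e, Vtx (esource e)] [Edg e]"
| edge_range: "e \<in> edges A \<Longrightarrow> S_rel A B [Vtx (erange e), Edg e] [Edg e]"
| star_source: "e \<in> edges A \<Longrightarrow> S_rel A B [Vtx (esource e), EdgStar e] [EdgStar e]"
| star_range: "e \<in> edges A \<Longrightarrow> S_rel A B [EdgStar e, Vtx (erange e)] [EdgStar e]"
| star_distinct: "e \<in> edges A \<Longrightarrow> f \<in> edges A \<Longrightarrow> e \<noteq> f \<Longrightarrow>
    S_rel A B [EdgStar e, Edg f] [Zero]"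
| star_same: "e \<in> edges A \<Longrightarrow> S_rel A B [EdgStar e, Edg e] [Vtx (esource e)]"
| self_similar: "e \<in> edges A \<Longrightarrow>
    S_rel A B [Grp (erange e) k, Edg e]
      [Edg (edge_act A B k e), Grp (esource e) (edge_section A B k e)]"

definition S_class :: "int^'n^'n \<Rightarrow> int^'n^'n \<Rightarrow> 'n gen list \<Rightarrow> 'n gen list set" where
  "S_class A B x = {y. S_rel A B x y}"

definition S_carrier :: "int^'n^'n \<Rightarrow> int^'n^'n \<Rightarrow> 'n gen list set set" where
  "S_carrier A B = S_class A B ` gen_words A"

definition S_mult ::
  "int^'n^'n \<Rightarrow> int^'n^'n \<Rightarrow> 'n gen list set \<Rightarrow> 'n gen list set \<Rightarrow> 'n gen list set" where
  "S_mult A B s t = (\<Union>x\<in>s. \<Union>y\<in>t. S_class A B (x @ y))"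

definition path_word :: "'n fpath \<Rightarrow> 'n gen list" where
  "path_word p = Vtx (prange p) # map Edg (pedges p)"

text \<open>\<open>S_elem A B p k q\<close> is the element \<open>p g\<^sup>k q*\<close>, where \<open>g\<close> generates the group at the common source
  of \<open>p\<close> and \<open>q\<close>.\<close>

definition S_elem ::
  "int^'n^'n \<Rightarrow> int^'n^'n \<Rightarrow> 'n fpath \<Rightarrow> int \<Rightarrow> 'n fpath \<Rightarrow> 'n gen list set" where
  "S_elem A B p k q =
     S_class A B (path_word p @ [Grp (psource p) k] @ word_star (path_word q))"

text \<open>\<open>S_acts A B s w z\<close>: the partial bijection of the nonzero element \<open>s\<close> is defined at \<open>w\<close>, with
  value \<open>z\<close>.\<close>

definition S_acts ::
  "int^'n^'n \<Rightarrow> int^'n^'n \<Rightarrow> 'n gen list set \<Rightarrow> 'n edge word \<Rightarrow> 'n edge word \<Rightarrow> bool" where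
  "S_acts A B s w z \<longleftrightarrow>
     (\<exists>p k q y. p \<in> fpaths A \<and> q \<in> fpaths A \<and> psource p = psource q \<and> s = S_elem A B p k q \<and>
        y \<in> ipaths A \<and> erange (y 0) = psource q \<and>
        w = pedges q \<frown> y \<and> z = pedges p \<frown> ipath_act A B k y)"

definition S_app ::
  "int^'n^'n \<Rightarrow> int^'n^'n \<Rightarrow> 'n gen list set \<Rightarrow> 'n edge word \<Rightarrow> 'n edge word" where
  "S_app A B s w = (THE z. S_acts A B s w z)"


section \<open>Topological groupoids and their Steinberg algebras\<close>

text \<open>A groupoid is given by its topological space of arrows, source and range maps into a set
  identified with the unit space, and the multiplication: \<open>gcomp G a b\<close> is the product \<open>a b\<close>, which is
  meaningful only if the source of \<open>a\<close> is the range of \<open>b\<close>.\<close>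

record ('g, 'x) top_groupoid =
  gtop :: "'g topology"
  gsource :: "'g \<Rightarrow> 'x"
  grange :: "'g \<Rightarrow> 'x"
  gcomp :: "'g \<Rightarrow> 'g \<Rightarrow> 'g"

definition gunits :: "('g, 'x) top_groupoid \<Rightarrow> 'g set" where
  "gunits G = {a \<in> topspace (gtop G). gsource G a = grange G a \<and> gcomp G a a = a}"

definition compact_open_bisection :: "('g, 'x) top_groupoid \<Rightarrow> 'g set \<Rightarrow> bool" where
  "compact_open_bisection G U \<longleftrightarrow> openin (gtop G) U \<and> compactin (gtop G) U \<and>
     inj_on (gsource G) U \<and> inj_on (grange G) U"

definition convolution ::
  "('g, 'x) top_groupoid \<Rightarrow> ('g \<Rightarrow> 'k::field) \<Rightarrow> ('g \<Rightarrow> 'k) \<Rightarrow> 'g \<Rightarrow> 'k" where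
  "convolution G f h c =
     (\<Sum>(a, b) \<in> {(a, b). a \<in> topspace (gtop G) \<and> b \<in> topspace (gtop G) \<and>
        gsource G a = grange G b \<and> gcomp G a b = c \<and> f a \<noteq> 0 \<and> h b \<noteq> 0}. f a * h b)"

definition steinberg_algebra :: "('g, 'x) top_groupoid \<Rightarrow> ('k::field, 'g \<Rightarrow> 'k) module" where
  "steinberg_algebra G = \<lparr>
     carrier = {f. \<exists>F a. finite F \<and> (\<forall>U\<in>F. compact_open_bisection G U) \<and>
                   f = (\<lambda>c. \<Sum>U\<in>F. a U * indicator U c)},
     monoid.mult = convolution G,
     one = indicator (gunits G),
     zero = (\<lambda>_. 0),
     add = (\<lambda>f h c. f c + h c),
     smult = (\<lambda>t f c. t * f c) \<rparr>"

definition singular_ideal :: "('g, 'x) top_groupoid \<Rightarrow> ('g \<Rightarrow> 'k::field) set" where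
  "singular_ideal G =
     {f \<in> carrier (steinberg_algebra G). (gtop G) interior_of {c. f c \<noteq> 0} = {}}"


section \<open>The groupoid of germs\<close>

definition quotient_topology :: "'a topology \<Rightarrow> ('a \<Rightarrow> 'b) \<Rightarrow> 'b topology" where
  "quotient_topology X f =
     topology (\<lambda>V. V \<subseteq> f ` topspace X \<and> openin X {x \<in> topspace X. f x \<in> V})"

lemma openin_quotient_topology:
  "openin (quotient_topology X f) V \<longleftrightarrow>
     V \<subseteq> f ` topspace X \<and> openin X {x \<in> topspace X. f x \<in> V}"
proof -
  let ?P = "\<lambda>V. V \<subseteq> f ` topspace X \<and> openin X {x \<in> topspace X. f x \<in> V}"
  have "istopology ?P"
    unfolding istopology_def
  proof (intro conjI allI impI)
    fix S T assume S: "?P S" and T: "?P T"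
    have "{x \<in> topspace X. f x \<in> S \<inter> T} =
        {x \<in> topspace X. f x \<in> S} \<inter> {x \<in> topspace X. f x \<in> T}"
      by blast
    then show "openin X {x \<in> topspace X. f x \<in> S \<inter> T}"
      using S T by (simp add: openin_Int)
    show "S \<inter> T \<subseteq> f ` topspace X"
      using S by blast
  next
    fix \<K> assume K: "\<forall>K\<in>\<K>. ?P K"
    have "{x \<in> topspace X. f x \<in> \<Union>\<K>} = (\<Union>K\<in>\<K>. {x \<in> topspace X. f x \<in> K})"
      by blast
    then show "openin X {x \<in> topspace X. f x \<in> \<Union>\<K>}"
      using K by auto
    show "\<Union>\<K> \<subseteq> f ` topspace X"
      using K by blast
  qed
  then show ?thesis
    by (simp add: quotient_topology_def)
qed

lemma topspace_quotient_topology: "topspace (quotient_topology X f) = f ` topspace X"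
proof -
  have "{x \<in> topspace X. f x \<in> f ` topspace X} = topspace X"
    by blast
  then have "openin (quotient_topology X f) (f ` topspace X)"
    by (simp add: openin_quotient_topology)
  then show ?thesis
    by (metis openin_quotient_topology openin_subset openin_topspace subset_antisym)
qed

lemma quotient_map_quotient_topology: "quotient_map X (quotient_topology X f) f"
  unfolding quotient_map_def topspace_quotient_topology
  by (auto simp: openin_quotient_topology)

definition germ_pairs ::
  "int^'n^'n \<Rightarrow> int^'n^'n \<Rightarrow> ('n gen list set \<times> 'n edge word) set" where
  "germ_pairs A B = {(s, w). \<exists>z. S_acts A B s w z}"

definition germ ::
  "int^'n^'n \<Rightarrow> int^'n^'n \<Rightarrow> 'n gen list set \<times> 'n edge word \<Rightarrow>
     ('n gen list set \<times> 'n edge word) set" where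
  "germ A B = (\<lambda>(s, w). {(t, z) \<in> germ_pairs A B. z = w \<and>
     (\<exists>x \<in> fpaths A. w \<in> cylinder A x \<and>
        S_mult A B s (S_class A B (path_word x)) = S_mult A B t (S_class A B (path_word x)))})"

definition germ_mult ::
  "int^'n^'n \<Rightarrow> int^'n^'n \<Rightarrow> ('n gen list set \<times> 'n edge word) set \<Rightarrow>
     ('n gen list set \<times> 'n edge word) set \<Rightarrow> ('n gen list set \<times> 'n edge word) set" where
  "germ_mult A B a b = (THE c. \<exists>s t w. (t, w) \<in> germ_pairs A B \<and>
     (s, S_app A B t w) \<in> germ_pairs A B \<and>
     a = germ A B (s, S_app A B t w) \<and> b = germ A B (t, w) \<and> c = germ A B (S_mult A B s t, w))"

definition KEP_groupoid ::
  "int^'n^'n \<Rightarrow> int^'n^'n \<Rightarrow>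
     (('n gen list set \<times> 'n edge word) set, 'n edge word) top_groupoid" where
  "KEP_groupoid A B = \<lparr>
     gtop = quotient_topology
       (subtopology (prod_topology (discrete_topology (S_carrier A B)) (ipath_topology A))
          (germ_pairs A B))
       (germ A B),
     gsource = (\<lambda>a. THE w. \<exists>s. (s, w) \<in> a),
     grange = (\<lambda>a. THE z. \<exists>s w. (s, w) \<in> a \<and> z = S_app A B s w),
     gcomp = germ_mult A B \<rparr>"

end

theory Submission
  imports Defs
begin

text \<open>
  Fix a vertex \<open>v\<close> with group \<open>\<langle>g\<rangle>\<close> and say that \<open>g\<^sup>k\<close> and \<open>g\<^sup>l\<close> fuse along an infinite path \<open>y\<close> with range
  \<open>v\<close> if they send some prefix of \<open>y\<close> to the same path, with the same section. This is the equality of their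
  germs at \<open>y\<close>. Over a small cylinder, a compact open bisection consists of the germs of a single
  semigroup element \<open>p g\<^sup>k x\<^sup>*\<close> or is empty (\<open>bisection_local_form\<close>), and germs with different \<open>p\<close> differ
  (\<open>germ_elem_eq_iff\<close>). So an element of the Steinberg algebra is locally given by finitely many coefficients
  \<open>b l\<close>, and its value at the germ of \<open>g\<^sup>k\<close> at \<open>y\<close> is the class sum: the sum of the \<open>b l\<close> such that \<open>g\<^sup>l\<close> fuses
  with \<open>g\<^sup>k\<close> along \<open>y\<close> (\<open>vertex_of_singular_element\<close>).

  Weights control fusion. The image and the section of an edge with \<open>B \<noteq> 0\<close> determine the exponent, so along paths
  all of whose edges have nonzero weight distinct exponents never fuse. After an edge with \<open>B = 0\<close> every section is
  trivial, so along a path with a prefix \<open>z\<close> of weight zero, \<open>g\<^sup>k\<close> and \<open>g\<^sup>l\<close> fuse if and only if they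
  agree on \<open>z\<close>; class sums are then constant on the cylinder of \<open>z\<close>.

  Suppose that the class sums of \<open>b\<close> are not all zero but vanish somewhere on every cylinder. Then they vanish
  at every path meeting weight zero. So some infinite path has only edges of nonzero weight, which by the
  pigeonhole principle gives a simple path followed by a simple cycle; and no cylinder consists of such
  paths, because at these the class sums are single coefficients of \<open>b\<close>. If \<open>v\<close> acted faithfully, one path, which may
  be extended to weight zero, would separate finitely many exponents and again isolate a coefficient
  (\<open>faithful_separates\<close>, \<open>class_sum_vanishing\<close>).

  Conversely, if \<open>g\<^sup>k\<close> with \<open>k \<noteq> 0\<close> acts trivially, the difference of the indicator functions of the bisections
  of the unit and of \<open>g\<^sup>k\<close> vanishes over all paths that meet weight zero, which are dense, but not over a path
  that follows the given cycle forever (\<open>singular_element_of_vertex\<close>).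

  The inverse semigroup enters as a presentation. Distinct elements are told apart by an action of words as partial
  injections on the states \<open>p g\<^sup>m\<close> together with the infinite paths (\<open>S_rel_word_rel\<close>).
\<close>

section \<open>Paths\<close>

text \<open>The recursive form of the path condition, which makes inductions over edge lists
  straightforward; \<open>FPath_fpaths_iff\<close> relates it to the index form.\<close>

fun walk :: "int^'n^'n \<Rightarrow> 'n \<Rightarrow> 'n edge list \<Rightarrow> 'n \<Rightarrow> bool" where
  "walk M u [] v \<longleftrightarrow> u = v"
| "walk M u (e # es) v \<longleftrightarrow> e \<in> edges M \<and> erange e = u \<and> walk M (esource e) es v"

lemma walk_append: "walk M u (xs @ ys) v \<longleftrightarrow> (\<exists>w. walk M u xs w \<and> walk M w ys v)"
  by (induction xs arbitrary: u) auto

lemma psource_simps [simp]: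
  "psource (FPath u []) = u"
  "psource (FPath u (e # es)) = psource (FPath (esource e) es)"
  by (auto simp: psource_def)

lemma walk_psource: "walk M u es v \<Longrightarrow> psource (FPath u es) = v"
  by (induction es arbitrary: u) auto

lemma FPath_Nil_fpaths [simp]: "FPath u [] \<in> fpaths M"
  by (simp add: fpaths_def)

lemma FPath_Cons_fpaths:
  "FPath u (e # es) \<in> fpaths M \<longleftrightarrow> e \<in> edges M \<and> erange e = u \<and> FPath (esource e) es \<in> fpaths M"
proof (cases es)
  case Nil
  then show ?thesis by (auto simp: fpaths_def)
next
  case (Cons f fs)
  have "(\<forall>i. Suc i < length (e # es) \<longrightarrow> esource ((e # es) ! i) = erange ((e # es) ! Suc i)) \<longleftrightarrow>
      esource e = erange f \<and> (\<forall>i. Suc i < length es \<longrightarrow> esource (es ! i) = erange (es ! Suc i))"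
    (is "(\<forall>i. ?P i) \<longleftrightarrow> ?Q")
  proof
    assume *: "\<forall>i. ?P i"
    then have "esource (es ! i) = erange (es ! Suc i)" if "Suc i < length es" for i
      using that by (auto dest: spec [of _ "Suc i"])
    moreover have "esource e = erange f"
      using * Cons by (auto dest: spec [of _ 0])
    ultimately show ?Q by blast
  next
    assume ?Q
    then show "\<forall>i. ?P i"
      using Cons by (auto simp: nth_Cons split: nat.split)
  qed
  then show ?thesis
    using Cons by (auto simp: fpaths_def)
qed

lemma FPath_fpaths_iff: "FPath u es \<in> fpaths M \<longleftrightarrow> (\<exists>v. walk M u es v)"
  by (induction es arbitrary: u) (auto simp: FPath_Cons_fpaths)

lemma walk_fpath: "p \<in> fpaths M \<Longrightarrow> walk M (prange p) (pedges p) (psource p)"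
  by (metis FPath_fpaths_iff fpath.collapse walk_psource)

lemma papp_fpath:
  assumes "p \<in> fpaths M" "q \<in> fpaths M" "psource p = prange q"
  shows "papp p q \<in> fpaths M" "psource (papp p q) = psource q"
  using assms walk_fpath [of p M] walk_fpath [of q M]
  by (auto simp: papp_def FPath_fpaths_iff walk_append intro!: walk_psource)

lemma build_nth: "(e ## w) i = (case i of 0 \<Rightarrow> e | Suc j \<Rightarrow> w j)"
  by (cases i) auto

lemma build_ipaths:
  "e ## w \<in> ipaths M \<longleftrightarrow> e \<in> edges M \<and> esource e = erange (w 0) \<and> w \<in> ipaths M"
proof
  assume *: "e ## w \<in> ipaths M"
  then have "w i \<in> edges M \<and> esource (w i) = erange (w (Suc i))" for i
    unfolding ipaths_def by (auto dest: spec [of _ "Suc i"])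
  moreover have "e \<in> edges M \<and> esource e = erange (w 0)"
    using * unfolding ipaths_def by (auto dest: spec [of _ 0])
  ultimately show "e \<in> edges M \<and> esource e = erange (w 0) \<and> w \<in> ipaths M"
    by (auto simp: ipaths_def)
next
  assume "e \<in> edges M \<and> esource e = erange (w 0) \<and> w \<in> ipaths M"
  then show "e ## w \<in> ipaths M"
    by (auto simp: ipaths_def build_nth split: nat.split)
qed

lemma Cons_conc: "(e # es) \<frown> y = e ## (es \<frown> y)"
  by (auto simp: fun_eq_iff conc_def build_nth nth_Cons split: nat.split)

lemma conc_ipaths:
  "walk M u es (erange (y 0)) \<Longrightarrow> y \<in> ipaths M \<Longrightarrow>
     es \<frown> y \<in> ipaths M \<and> erange ((es \<frown> y) 0) = u"
  by (induction es arbitrary: u) (auto simp: Cons_conc build_ipaths)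

lemma suffix_ipaths: "w \<in> ipaths M \<Longrightarrow> suffix n w \<in> ipaths M"
  by (auto simp: ipaths_def)

abbreviation initial :: "nat \<Rightarrow> 'a word \<Rightarrow> 'a list" where
  "initial n w \<equiv> subsequence w 0 n"

lemma initial_split: "m \<le> n \<Longrightarrow> initial n y = initial m y @ subsequence y m n"
  using subsequence_append [where i = m and j = "n - m" and w = y] by simp

lemma walk_ipath: "w \<in> ipaths M \<Longrightarrow> walk M (erange (w 0)) (initial n w) (erange (w n))"
  by (induction n) (auto simp: walk_append ipaths_def)

definition ptake :: "nat \<Rightarrow> 'n edge word \<Rightarrow> 'n fpath" where
  "ptake n w = FPath (erange (w 0)) (initial n w)"

lemma pedges_ptake [simp]: "pedges (ptake n w) = initial n w"
  and prange_ptake [simp]: "prange (ptake n w) = erange (w 0)"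
  by (simp_all add: ptake_def)

lemma ptake_fpaths:
  assumes "w \<in> ipaths M"
  shows "ptake n w \<in> fpaths M" "psource (ptake n w) = erange (w n)"
  using walk_ipath [OF assms, of n] unfolding ptake_def
  by (auto simp: FPath_fpaths_iff intro: walk_psource)

text \<open>Membership in a cylinder only depends on a prefix of fixed length. The topological arguments
  below therefore work with the neighbourhoods \<open>cylinder M (ptake n w)\<close> of \<open>w\<close>, which decrease with \<open>n\<close>.\<close>

lemma cylinder_iff:
  assumes "x \<in> fpaths M"
  shows "w \<in> cylinder M x \<longleftrightarrow> w \<in> ipaths M \<and> ptake (length (pedges x)) w = x"
proof
  assume "w \<in> cylinder M x"
  then obtain y where y: "w = pedges x \<frown> y" "w \<in> ipaths M" "y \<in> ipaths M" "erange (y 0) = psource x"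
    by (auto simp: cylinder_def)
  then have "erange (w 0) = prange x"
    using conc_ipaths walk_fpath assms by metis
  then show "w \<in> ipaths M \<and> ptake (length (pedges x)) w = x"
    using y by (simp add: ptake_def)
next
  assume w: "w \<in> ipaths M \<and> ptake (length (pedges x)) w = x"
  let ?n = "length (pedges x)"
  have "w = pedges x \<frown> suffix ?n w"
    using w by (metis pedges_ptake prefix_suffix)
  moreover have "erange (suffix ?n w 0) = psource x"
    using w ptake_fpaths(2) [of w M ?n] by simp
  ultimately show "w \<in> cylinder M x"
    unfolding cylinder_def using w suffix_ipaths by (smt (verit) mem_Collect_eq)
qed

lemma ptake_cylinder: "w \<in> ipaths M \<Longrightarrow> w \<in> cylinder M (ptake n w)"
  by (simp add: cylinder_iff ptake_fpaths)

lemma cylinder_ptake_iff: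
  "w \<in> ipaths M \<Longrightarrow> w' \<in> cylinder M (ptake n w) \<longleftrightarrow> w' \<in> ipaths M \<and> ptake n w' = ptake n w"
  by (simp add: cylinder_iff ptake_fpaths)

lemma ptake_mono:
  assumes "ptake n w = ptake n w'" "m \<le> n"
  shows "ptake m w = ptake m w'"
proof -
  have "take m (initial n w) = take m (initial n w')" "erange (w 0) = erange (w' 0)"
    using assms(1) by (auto simp: ptake_def)
  then show ?thesis
    using assms(2) by (simp add: ptake_def min_absorb1)
qed

lemma edges_finite: "finite (edges (M :: int^'n::finite^'n))"
proof -
  have "edges M \<subseteq> (\<Union>u v. (\<lambda>i. Edge u v i) ` {0..<M $ u $ v})"
  proof
    fix e assume "e \<in> edges M"
    then show "e \<in> (\<Union>u v. (\<lambda>i. Edge u v i) ` {0..<M $ u $ v})"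
      by (cases e) (force simp: edges_def)
  qed
  then show ?thesis
    by (rule finite_subset) auto
qed

section \<open>The action on paths\<close>

text \<open>The exponent of \<open>g\<^sup>k|\<^sub>p\<close> for the path \<open>p\<close> with the given edges.\<close>

fun edges_section :: "int^'n^'n \<Rightarrow> int^'n^'n \<Rightarrow> int \<Rightarrow> 'n edge list \<Rightarrow> int" where
  "edges_section A B k [] = k"
| "edges_section A B k (e # es) = edges_section A B (edge_section A B k e) es"

locale katsura =
  fixes A B :: "int^'n^'n"
  assumes pair: "katsura_pair A B"
begin

abbreviation act :: "int \<Rightarrow> 'n edge list \<Rightarrow> 'n edge list" where
  "act \<equiv> edges_act A B"

abbreviation sect :: "int \<Rightarrow> 'n edge list \<Rightarrow> int" where
  "sect \<equiv> edges_section A B"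

lemma edge_act_simps [simp]:
  "erange (edge_act A B k e) = erange e"
  "esource (edge_act A B k e) = esource e"
  by (simp_all add: edge_act_def)

lemma edge_act_edges: "e \<in> edges A \<Longrightarrow> edge_act A B k e \<in> edges A"
  by (auto simp: edges_def edge_act_def)

lemma edge_act_zero: "e \<in> edges A \<Longrightarrow> edge_act A B 0 e = e"
  by (cases e) (auto simp: edges_def edge_act_def)

lemma edge_section_zero: "e \<in> edges A \<Longrightarrow> edge_section A B 0 e = 0"
  by (cases e) (auto simp: edges_def edge_section_def)

lemma edge_act_add:
  "e \<in> edges A \<Longrightarrow> edge_act A B (k + l) e = edge_act A B k (edge_act A B l e)"
  by (auto simp: edges_def edge_act_def distrib_right add.assoc mod_add_right_eq)

text \<open>The cocycle identity \<open>(gh)|\<^sub>e = g|\<^bsub>h(e)\<^esub> h|\<^sub>e\<close>: dividing \<open>l b + r\<close> by \<open>a\<close> first and then adding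
  \<open>k b\<close> to the remainder splits the quotient of \<open>(k + l) b + r\<close> into two summands.\<close>

lemma edge_section_add:
  assumes "e \<in> edges A"
  shows "edge_section A B (k + l) e = edge_section A B k (edge_act A B l e) + edge_section A B l e"
proof -
  define a b r where "a = A $ erange e $ esource e" and "b = B $ erange e $ esource e"
    and "r = eindex e"
  have "a > 0"
    using assms by (auto simp: edges_def a_def)
  have "(k + l) * b + r = (k * b + (l * b + r) mod a) + a * ((l * b + r) div a)"
    by (simp add: algebra_simps)
  then have "((k + l) * b + r) div a = (k * b + (l * b + r) mod a) div a + (l * b + r) div a"
    using \<open>a > 0\<close> by (metis add.commute div_mult_self2 less_irrefl mult.commute)
  then show ?thesis
    by (simp add: edge_section_def edge_act_def a_def b_def r_def)
qed

lemma act_append: "act k (xs @ ys) = act k xs @ act (sect k xs) ys"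
  and sect_append: "sect k (xs @ ys) = sect (sect k xs) ys"
  by (induction xs arbitrary: k) auto

lemma length_act [simp]: "length (act k es) = length es"
  by (induction es arbitrary: k) auto

lemma walk_act: "walk A u es v \<Longrightarrow> walk A u (act k es) v"
  by (induction es arbitrary: u k) (auto simp: edge_act_edges)

lemma act_zero: "walk A u es v \<Longrightarrow> act 0 es = es"
  and sect_zero: "walk A u es v \<Longrightarrow> sect 0 es = 0"
  by (induction es arbitrary: u) (auto simp: edge_act_zero edge_section_zero)

lemma act_add: "walk A u es v \<Longrightarrow> act (k + l) es = act k (act l es)"
  and sect_add: "walk A u es v \<Longrightarrow> sect (k + l) es = sect k (act l es) + sect l es"
  by (induction es arbitrary: u k l) (auto simp: edge_act_add edge_section_add)

lemma ipath_section_build: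
  "ipath_section A B k (e ## w) (Suc i) = ipath_section A B (edge_section A B k e) w i"
  by (induction i) auto

lemma ipath_act_build:
  "ipath_act A B k (e ## w) = edge_act A B k e ## ipath_act A B (edge_section A B k e) w"
proof
  fix i
  show "ipath_act A B k (e ## w) i = (edge_act A B k e ## ipath_act A B (edge_section A B k e) w) i"
    by (cases i) (auto simp: ipath_act_def ipath_section_build simp del: ipath_section.simps(2))
qed

lemma ipath_act_ipaths: "w \<in> ipaths A \<Longrightarrow> ipath_act A B k w \<in> ipaths A"
  by (auto simp: ipaths_def ipath_act_def edge_act_edges)

lemma erange_ipath_act [simp]: "erange (ipath_act A B k w 0) = erange (w 0)"
  by (simp add: ipath_act_def)

lemma ipath_act_zero:
  assumes "w \<in> ipaths A"
  shows "ipath_act A B 0 w = w"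
proof -
  have "ipath_section A B 0 w i = 0" for i
    using assms by (induction i) (auto simp: ipaths_def edge_section_zero)
  then show ?thesis
    using assms by (auto simp: ipath_act_def ipaths_def edge_act_zero)
qed

lemma ipath_act_add:
  assumes "w \<in> ipaths A"
  shows "ipath_act A B (k + l) w = ipath_act A B k (ipath_act A B l w)"
proof -
  have "ipath_section A B (k + l) w i =
      ipath_section A B k (ipath_act A B l w) i + ipath_section A B l w i" for i
    using assms by (induction i) (auto simp: ipaths_def ipath_act_def edge_section_add)
  then show ?thesis
    using assms by (auto simp: ipath_act_def ipaths_def edge_act_add)
qed

end

section \<open>Semigroup words as partial injections\<close>

text \<open>Semigroup words will act on two kinds of states: \<open>Fin u es m\<close> stands for \<open>p g\<^sup>m\<close>, where \<open>p\<close> is the path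
  with range \<open>u\<close> and edges \<open>es\<close>, and \<open>Inf w\<close> for an infinite path. The action on infinite paths
  determines the ranges of germs, but it does not separate semigroup elements when the group bundle
  acts non-faithfully. The states \<open>p g\<^sup>m\<close> do: \<open>p g q\<^sup>*\<close> sends \<open>q\<close> to \<open>p g\<close>.\<close>

datatype 'n state = Fin 'n "'n edge list" int | Inf "'n edge word"

fun state_range :: "'n state \<Rightarrow> 'n" where
  "state_range (Fin v es m) = v"
| "state_range (Inf w) = erange (w 0)"

fun push :: "'n edge \<Rightarrow> 'n state \<Rightarrow> 'n state" where
  "push e (Fin v es m) = Fin (erange e) (e # es) m"
| "push e (Inf w) = Inf (e ## w)"

fun pushes :: "'n edge list \<Rightarrow> 'n state \<Rightarrow> 'n state" where
  "pushes [] s = s"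
| "pushes (e # es) s = push e (pushes es s)"

lemma push_edge_eq: "push e s = push f t \<Longrightarrow> e = f"
  by (cases s; cases t) (auto dest: fun_cong [of _ _ 0])

lemma push_inject:
  assumes "push e s = push e t" "state_range s = state_range t"
  shows "s = t"
proof -
  have inj: "w = w'" if "e ## w = e ## w'" for w w' :: "'a edge word"
  proof
    show "w i = w' i" for i
      using fun_cong [OF that, of "Suc i"] by simp
  qed
  show ?thesis
    using assms by (cases s; cases t) (auto dest: inj)
qed

lemma state_range_push [simp]: "state_range (push e s) = erange e"
  by (cases s) auto

lemma pushes_Inf: "pushes es (Inf y) = Inf (es \<frown> y)"
  by (induction es) (auto simp: Cons_conc)

context katsura
begin

fun state_ok :: "'n state \<Rightarrow> bool" where
  "state_ok (Fin v es m) \<longleftrightarrow> (\<exists>u. walk A v es u)"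
| "state_ok (Inf w) \<longleftrightarrow> w \<in> ipaths A"

fun state_act :: "int \<Rightarrow> 'n state \<Rightarrow> 'n state" where
  "state_act k (Fin v es m) = Fin v (act k es) (sect k es + m)"
| "state_act k (Inf w) = Inf (ipath_act A B k w)"

lemma state_range_act [simp]: "state_range (state_act k s) = state_range s"
  by (cases s) auto

lemma state_ok_act: "state_ok s \<Longrightarrow> state_ok (state_act k s)"
  by (cases s) (auto simp: ipath_act_ipaths intro: walk_act)

lemma state_act_zero: "state_ok s \<Longrightarrow> state_act 0 s = s"
  by (cases s) (auto simp: ipath_act_zero act_zero sect_zero)

lemma state_act_add: "state_ok s \<Longrightarrow> state_act (k + l) s = state_act k (state_act l s)"
  by (cases s) (auto simp: ipath_act_add act_add sect_add)

lemma state_act_push: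
  "state_act k (push e s) = push (edge_act A B k e) (state_act (edge_section A B k e) s)"
  by (cases s) (auto simp: ipath_act_build)

lemma state_ok_push:
  "state_range s = esource e \<Longrightarrow> state_ok (push e s) \<longleftrightarrow> e \<in> edges A \<and> state_ok s"
  by (cases s) (auto simp: build_ipaths)

fun gen_rel :: "'n gen \<Rightarrow> ('n state \<times> 'n state) set" where
  "gen_rel Zero = {}"
| "gen_rel (Grp v k) = {(s, state_act k s) | s. state_ok s \<and> state_range s = v}"
| "gen_rel (Edg e) = {(s, push e s) | s. e \<in> edges A \<and> state_ok s \<and> state_range s = esource e}"
| "gen_rel (EdgStar e) = {(push e s, s) | s. e \<in> edges A \<and> state_ok s \<and> state_range s = esource e}"

fun word_rel :: "'n gen list \<Rightarrow> ('n state \<times> 'n state) set" where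
  "word_rel [] = Id"
| "word_rel (g # x) = word_rel x O gen_rel g"

lemma word_rel_append: "word_rel (x @ y) = word_rel y O word_rel x"
  by (induction x) auto

lemma gen_rel_star: "gen_rel (gen_star g) = (gen_rel g)\<inverse>"
proof (cases g)
  case (Grp v k)
  have inv: "(t, s) \<in> gen_rel (Grp v (- l))" if st: "(s, t) \<in> gen_rel (Grp v l)" for s t l
  proof -
    have s: "state_ok s" "t = state_act l s" "state_range s = v"
      using st by auto
    then have "state_act (- l) t = s"
      using state_act_add [of s "- l" l] by (simp add: state_act_zero)
    moreover have "state_ok t" "state_range t = v"
      using s state_ok_act by auto
    ultimately show ?thesis
      by force
  qed
  have "(s, t) \<in> gen_rel (Grp v (- k)) \<longleftrightarrow> (t, s) \<in> gen_rel (Grp v k)" for s t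
    using inv [of s t "- k"] inv [of t s k] by auto
  then show ?thesis
    using Grp by (simp add: set_eq_iff split_paired_all del: gen_rel.simps)
qed auto

lemma word_rel_star: "word_rel (word_star x) = (word_rel x)\<inverse>"
  by (induction x) (auto simp: word_star_def word_rel_append gen_rel_star)

lemma gen_rel_single_valued: "single_valued (gen_rel g)"
  by (cases g) (auto simp: single_valued_def dest: push_inject)

lemma word_rel_single_valued: "single_valued (word_rel x)"
  by (induction x) (auto simp: gen_rel_single_valued intro: single_valued_relcomp)

lemma word_rel_inj: "(s, t) \<in> word_rel x \<Longrightarrow> (s', t) \<in> word_rel x \<Longrightarrow> s = s'"
  using word_rel_single_valued [of "word_star x"] by (auto simp: word_rel_star single_valued_def)

lemma word_rel_fun: "(s, t) \<in> word_rel x \<Longrightarrow> (s, t') \<in> word_rel x \<Longrightarrow> t = t'"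
  using word_rel_single_valued [of x] by (auto simp: single_valued_def)

lemma word_rel_idem: "word_rel (x @ word_star x) = Id_on (Range (word_rel x))"
  by (auto simp: word_rel_append word_rel_star dest: word_rel_fun)

text \<open>A presented semigroup is hard to compute in, because one has to show that elements differ. As every
  word acts as a partial injection and \<open>word_star\<close> as its converse, the identities of inverse
  semigroups hold for these actions automatically, and only the relations between generators need
  a verification.\<close>

lemma S_rel_word_rel: "S_rel A B x y \<Longrightarrow> word_rel x = word_rel y"
proof (induction rule: S_rel.induct)
  case (mult x x' y y')
  then show ?case by (simp add: word_rel_append)
next
  case (inverse x)
  then show ?case
    by (auto simp: word_rel_append word_rel_star dest: word_rel_fun word_rel_inj)
next
  case (idem_commute x y)
  have "word_rel (x @ word_star x @ y @ word_star y) =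
      word_rel (y @ word_star y) O word_rel (x @ word_star x)" for x y
    by (metis append.assoc word_rel_append)
  then show ?case
    by (simp only: word_rel_idem) auto
next
  case (group_mult v k l)
  have "word_rel [Grp v k, Grp v l] =
      {(s, state_act k (state_act l s)) | s. state_ok s \<and> state_range s = v}"
    by (auto simp: state_ok_act)
  then show ?case
    by (auto simp: state_act_add)
next
  case (self_similar e k)
  then show ?case
    by (auto simp: state_act_push state_ok_push edge_act_edges state_ok_act) 
next
  case (star_distinct e f)
  then show ?case
    by (auto dest: push_edge_eq)
next
  case (star_same e)
  then show ?case
    by (auto simp: state_act_zero state_ok_push) (metis push_inject)
qed (auto simp: word_rel_append state_act_zero state_ok_push)

end

section \<open>Products in the inverse semigroup\<close>

lemma lists_gen_words: "x \<in> gen_words M \<longleftrightarrow> x \<in> lists (gens M) \<and> x \<noteq> []"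
  by (auto simp: gen_words_def)

lemma gens_simps [simp]:
  "Zero \<in> gens M" "Grp v k \<in> gens M"
  "Edg e \<in> gens M \<longleftrightarrow> e \<in> edges M" "EdgStar e \<in> gens M \<longleftrightarrow> e \<in> edges M"
  by (auto simp: gens_def)

lemma walk_edges: "walk M u es v \<Longrightarrow> set es \<subseteq> edges M"
  by (induction es arbitrary: u) auto

lemma map_Edg_lists: "walk M u es v \<Longrightarrow> map Edg es \<in> lists (gens M)"
  using walk_edges by fastforce

lemma map_EdgStar_lists: "walk M u es v \<Longrightarrow> rev (map EdgStar es) \<in> lists (gens M)"
  using walk_edges by fastforce

lemma word_star_path_word:
  "word_star (path_word q) = rev (map EdgStar (pedges q)) @ [Vtx (prange q)]"
  by (simp add: word_star_def path_word_def comp_def)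

lemma path_word_gen_words [simp]: "p \<in> fpaths M \<Longrightarrow> path_word p \<in> gen_words M"
  using map_Edg_lists [OF walk_fpath] by (auto simp: lists_gen_words path_word_def)

lemma gen_words_append [simp]:
  "x \<in> gen_words M \<Longrightarrow> y \<in> gen_words M \<Longrightarrow> x @ y \<in> gen_words M"
  by (simp add: lists_gen_words)

lemma path_word_papp: "path_word (papp p q) = path_word p @ map Edg (pedges q)"
  by (simp add: path_word_def papp_def)

definition elem_word :: "'n fpath \<Rightarrow> int \<Rightarrow> 'n fpath \<Rightarrow> 'n gen list" where
  "elem_word p k q = path_word p @ [Grp (psource p) k] @ word_star (path_word q)"

lemma elem_word_gen_words [simp]:
  "p \<in> fpaths M \<Longrightarrow> q \<in> fpaths M \<Longrightarrow> elem_word p k q \<in> gen_words M"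
  using map_EdgStar_lists [OF walk_fpath, of q] path_word_gen_words [of p M]
  by (auto simp: lists_gen_words elem_word_def word_star_path_word)

lemma S_elem_alt: "S_elem A B p k q = S_class A B (elem_word p k q)"
  by (simp add: S_elem_def elem_word_def)

lemma S_class_eqI:
  assumes "S_rel A B x y"
  shows "S_class A B x = S_class A B y"
  unfolding S_class_def
  using S_rel.trans [OF assms] S_rel.trans [OF S_rel.sym [OF assms]] by blast

lemma S_mult_class:
  assumes "x \<in> gen_words A" "y \<in> gen_words A"
  shows "S_mult A B (S_class A B x) (S_class A B y) = S_class A B (x @ y)"
proof -
  have "S_class A B (x' @ y') = S_class A B (x @ y)" if "x' \<in> S_class A B x" "y' \<in> S_class A B y" for x' y'
    using that by (intro S_class_eqI [symmetric] S_rel.mult) (simp_all add: S_class_def)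
  moreover have "S_class A B x \<noteq> {}" "S_class A B y \<noteq> {}"
    using assms S_rel.refl unfolding S_class_def by blast+
  ultimately show ?thesis
    unfolding S_mult_def by (intro SUP_eq_const)
qed

lemma S_rel_context:
  assumes "S_rel A B x y" "a \<in> lists (gens A)" "b \<in> lists (gens A)"
  shows "S_rel A B (a @ x @ b) (a @ y @ b)"
proof -
  have "S_rel A B (x @ b) (y @ b)"
    using assms by (cases "b = []") (auto simp: lists_gen_words intro!: S_rel.mult S_rel.refl)
  then show ?thesis
    using assms by (cases "a = []") (auto simp: lists_gen_words intro!: S_rel.mult S_rel.refl)
qed

text \<open>The innermost pair \<open>e\<^sup>* e\<close> of \<open>q\<^sup>* q\<close> cancels first, which leaves a shorter word of the same form.\<close>

lemma S_rel_star_walk: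
  "walk A u es v \<Longrightarrow> S_rel A B (rev (map EdgStar es) @ [Vtx u] @ map Edg es) [Vtx v]"
proof (induction es arbitrary: u)
  case Nil
  then show ?case
    by (auto simp: lists_gen_words intro: S_rel.refl)
next
  case (Cons e es)
  then have e: "e \<in> edges A" "erange e = u" and es: "walk A (esource e) es v"
    by auto
  have "S_rel A B ([EdgStar e] @ [Vtx u, Edg e] @ []) ([EdgStar e] @ [Edg e] @ [])"
    using e by (intro S_rel_context) (auto intro: S_rel.intros)
  then have "S_rel A B [EdgStar e, Vtx u, Edg e] [Vtx (esource e)]"
    using S_rel.star_same [OF e(1)] by (auto intro: S_rel.trans)
  then have "S_rel A B (rev (map EdgStar es) @ [EdgStar e, Vtx u, Edg e] @ map Edg es)
      (rev (map EdgStar es) @ [Vtx (esource e)] @ map Edg es)"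
    by (rule S_rel_context) (use map_Edg_lists [OF es] map_EdgStar_lists [OF es] in auto)
  then show ?case
    using Cons.IH [OF es] by (auto intro: S_rel.trans)
qed

lemma S_rel_act_walk:
  "walk A u es v \<Longrightarrow>
     S_rel A B ([Grp u k] @ map Edg es) (map Edg (edges_act A B k es) @ [Grp v (edges_section A B k es)])"
proof (induction es arbitrary: u k)
  case Nil
  then show ?case
    by (auto simp: lists_gen_words intro: S_rel.refl)
next
  case (Cons e es)
  then have e: "e \<in> edges A" "erange e = u" and es: "walk A (esource e) es v"
    by auto
  have e': "edge_act A B k e \<in> edges A"
    using e by (auto simp: edges_def edge_act_def)
  have "S_rel A B ([] @ [Grp u k, Edg e] @ map Edg es)
      ([] @ [Edg (edge_act A B k e), Grp (esource e) (edge_section A B k e)] @ map Edg es)"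
    using map_Edg_lists [OF es] S_rel.self_similar [OF e(1), of B k] e by (intro S_rel_context) auto
  moreover have "S_rel A B ([Edg (edge_act A B k e)] @ ([Grp (esource e) (edge_section A B k e)] @ map Edg es) @ [])
      ([Edg (edge_act A B k e)] @ (map Edg (edges_act A B (edge_section A B k e) es) @
         [Grp v (edges_section A B (edge_section A B k e) es)]) @ [])"
    using e' by (intro S_rel_context Cons.IH es) auto
  ultimately show ?case
    by (auto intro: S_rel.trans)
qed

lemma S_rel_path_word_Vtx:
  assumes "p \<in> fpaths A"
  shows "S_rel A B (path_word p @ [Vtx (psource p)]) (path_word p)"
proof (cases "pedges p" rule: rev_cases)
  case Nil
  then show ?thesis
    using S_rel.group_mult [of A B "prange p" 0 0] by (simp add: path_word_def psource_def)
next
  case (snoc es e)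
  have w: "walk A (prange p) (es @ [e]) (psource p)"
    using walk_fpath [OF assms] snoc by simp
  then obtain u where u: "walk A (prange p) es u" "e \<in> edges A"
    by (auto simp: walk_append)
  have "S_rel A B ((Vtx (prange p) # map Edg es) @ [Edg e, Vtx (esource e)] @ [])
      ((Vtx (prange p) # map Edg es) @ [Edg e] @ [])"
    using map_Edg_lists [OF u(1)] u(2) by (intro S_rel_context) (auto intro: S_rel.intros)
  moreover have "psource p = esource e"
    using snoc by (simp add: psource_def)
  ultimately show ?thesis
    using snoc by (simp add: path_word_def)
qed

lemma S_mult_path_path:
  assumes "x \<in> gen_words A" "p \<in> fpaths A" "q \<in> fpaths A" "psource p = prange q"
  shows "S_mult A B (S_class A B x) (S_class A B (path_word (papp p q))) =
    S_class A B ((x @ path_word p) @ path_word q)"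
proof -
  have "S_rel A B ([] @ (path_word p @ [Vtx (psource p)]) @ map Edg (pedges q))
      ([] @ path_word p @ map Edg (pedges q))"
    using S_rel_path_word_Vtx [OF assms(2)] map_Edg_lists [OF walk_fpath [OF assms(3)]]
    by (intro S_rel_context) auto
  then have "S_rel A B (path_word p @ path_word q) (path_word (papp p q))"
    using assms by (simp add: path_word_papp) (simp add: path_word_def)
  then have "S_rel A B (x @ (path_word p @ path_word q) @ []) (x @ path_word (papp p q) @ [])"
    using assms by (intro S_rel_context) (auto simp: lists_gen_words)
  then have "S_class A B ((x @ path_word p) @ path_word q) = S_class A B (x @ path_word (papp p q))"
    by (intro S_class_eqI) simp
  then show ?thesis
    using assms by (simp add: S_mult_class papp_fpath)
qed

text \<open>\<open>q\<^sup>* (q r)\<close> collapses to \<open>r\<close>, and \<open>g\<close> then moves past the edges of \<open>r\<close> one at a time.\<close>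

lemma S_elem_mult_path:
  assumes "p \<in> fpaths A" "q \<in> fpaths A" "r \<in> fpaths A" "psource p = psource q" "psource q = prange r"
  shows "S_mult A B (S_elem A B p k q) (S_class A B (path_word (papp q r))) =
    S_class A B (path_word (papp p (fpath_act A B k r)) @
      [Grp (psource r) (edges_section A B k (pedges r))])"
proof -
  let ?v = "psource q" and ?R = "map Edg (pedges r)"
  have lists: "path_word p \<in> lists (gens A)" "?R \<in> lists (gens A)"
      "map Edg (pedges q) \<in> lists (gens A)" "rev (map EdgStar (pedges q)) \<in> lists (gens A)"
    using path_word_gen_words [OF assms(1)] map_Edg_lists [OF walk_fpath [OF assms(3)]]
      map_Edg_lists [OF walk_fpath [OF assms(2)]] map_EdgStar_lists [OF walk_fpath [OF assms(2)]]
    by (simp_all add: lists_gen_words)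
  have q: "walk A (prange q) (pedges q) ?v" and r: "walk A ?v (pedges r) (psource r)"
    using assms walk_fpath by metis+
  have vv: "S_rel A B [Grp u k, Grp u 0] [Grp u k]" for u k
    using S_rel.group_mult [of A B u k 0] by simp
  let ?S = "rev (map EdgStar (pedges q))" and ?u = "prange q"
  have "S_rel A B ((path_word p @ [Grp ?v k] @ ?S) @ [Vtx ?u, Vtx ?u] @ (map Edg (pedges q) @ ?R))
      ((path_word p @ [Grp ?v k] @ ?S) @ [Vtx ?u] @ (map Edg (pedges q) @ ?R))"
    using lists by (intro S_rel_context vv) auto
  also have "(path_word p @ [Grp ?v k] @ ?S) @ [Vtx ?u] @ (map Edg (pedges q) @ ?R) =
      (path_word p @ [Grp ?v k]) @ (?S @ [Vtx ?u] @ map Edg (pedges q)) @ ?R"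
    by simp
  finally (back_subst) have
    "S_rel A B (elem_word p k q @ path_word (papp q r))
       ((path_word p @ [Grp ?v k]) @ (?S @ [Vtx ?u] @ map Edg (pedges q)) @ ?R)"
    using assms(4) by (simp add: elem_word_def word_star_path_word path_word_papp)
      (simp add: path_word_def)
  moreover have "S_rel A B ((path_word p @ [Grp ?v k]) @ (?S @ [Vtx ?u] @ map Edg (pedges q)) @ ?R)
      ((path_word p @ [Grp ?v k]) @ [Vtx ?v] @ ?R)"
    using lists by (intro S_rel_context S_rel_star_walk q) auto
  moreover have "S_rel A B (path_word p @ [Grp ?v k, Vtx ?v] @ ?R) (path_word p @ [Grp ?v k] @ ?R)"
    using lists by (intro S_rel_context vv) auto
  moreover have "S_rel A B (path_word p @ ([Grp ?v k] @ ?R) @ [])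
     (path_word p @ (map Edg (edges_act A B k (pedges r)) @ [Grp (psource r) (edges_section A B k (pedges r))]) @ [])"
    using lists by (intro S_rel_context S_rel_act_walk r) auto
  ultimately have rel: "S_rel A B (elem_word p k q @ path_word (papp q r))
     (path_word (papp p (fpath_act A B k r)) @ [Grp (psource r) (edges_section A B k (pedges r))])"
    by (simp add: path_word_papp fpath_act_def) (blast intro: S_rel.trans)
  have "S_class A B (elem_word p k q @ path_word (papp q r)) =
      S_class A B (path_word (papp p (fpath_act A B k r)) @ [Grp (psource r) (edges_section A B k (pedges r))])"
    by (rule S_class_eqI [OF rel])
  then show ?thesis
    using assms by (simp add: S_elem_alt S_mult_class papp_fpath)
qed

lemma papp_Nil [simp]: "papp p (FPath u []) = p"
  by (cases p) (simp add: papp_def)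

lemma pushes_Fin: "walk M u es v \<Longrightarrow> pushes es (Fin v fs m) = Fin u (es @ fs) m"
  by (induction es arbitrary: u) auto

context katsura
begin

lemma fpath_act_fpaths:
  assumes "r \<in> fpaths A"
  shows "fpath_act A B k r \<in> fpaths A" "psource (fpath_act A B k r) = psource r"
    "prange (fpath_act A B k r) = prange r"
  using walk_act [OF walk_fpath [OF assms], of k] by (auto simp: fpath_act_def FPath_fpaths_iff walk_psource)

text \<open>Hence \<open>p g q\<^sup>*\<close> has the same germs over the cylinder of \<open>q r\<close> as \<open>p (g\<cdot>r) g|\<^sub>r (q r)\<^sup>*\<close>. This allows replacing
  \<open>q\<close> by an arbitrarily long prefix of the infinite path at which a germ is taken.\<close>

lemma S_elem_extend:
  assumes "p \<in> fpaths A" "q \<in> fpaths A" "r \<in> fpaths A" "psource p = psource q" "psource q = prange r"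
  shows "S_mult A B (S_elem A B p k q) (S_class A B (path_word (papp q r))) =
    S_mult A B (S_elem A B (papp p (fpath_act A B k r)) (sect k (pedges r)) (papp q r))
      (S_class A B (path_word (papp q r)))"
proof -
  let ?P = "papp p (fpath_act A B k r)" and ?x = "papp q r"
  have "?P \<in> fpaths A" "?x \<in> fpaths A" "psource ?P = psource r" "psource ?x = psource r"
    using assms by (simp_all add: papp_fpath fpath_act_fpaths)
  then show ?thesis
    using S_elem_mult_path [of ?P A ?x "FPath (psource r) []" B] assms S_elem_mult_path [of p A q r B k]
    by (simp add: fpath_act_def)
qed

definition elem_rel :: "'n gen list set \<Rightarrow> ('n state \<times> 'n state) set" where
  "elem_rel s = (\<Union>x\<in>s. word_rel x)"

lemma elem_rel_class: "x \<in> gen_words A \<Longrightarrow> elem_rel (S_class A B x) = word_rel x"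
  unfolding elem_rel_def S_class_def by (auto dest: S_rel_word_rel intro: S_rel.refl)

lemma state_pushes:
  "walk A u es v \<Longrightarrow> state_ok s \<Longrightarrow> state_range s = v \<Longrightarrow>
     state_ok (pushes es s) \<and> state_range (pushes es s) = u"
  by (induction es arbitrary: u) (auto simp: state_ok_push)

lemma path_word_rel:
  assumes "p \<in> fpaths A"
  shows "word_rel (path_word p) = {(s, pushes (pedges p) s) | s. state_ok s \<and> state_range s = psource p}"
proof -
  have "word_rel (Vtx u # map Edg es) = {(s, pushes es s) | s. state_ok s \<and> state_range s = v}"
    if "walk A u es v" for u es v
    using that
  proof (induction es arbitrary: u)
    case Nil
    then show ?case by (auto simp: state_act_zero)
  next
    case (Cons e es)
    then have e: "e \<in> edges A" "erange e = u" and es: "walk A (esource e) es v"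
      by auto
    have "word_rel (Vtx u # map Edg (e # es)) = word_rel (Vtx (esource e) # map Edg es) O gen_rel (Edg e)"
      using e by (auto simp: state_act_zero state_ok_push relcomp_unfold)
    also have "\<dots> = {(s, pushes (e # es) s) | s. state_ok s \<and> state_range s = v}"
      unfolding Cons.IH [OF es] using e state_pushes [OF es] by auto
    finally show ?case .
  qed
  then show ?thesis
    using walk_fpath [OF assms] by (simp add: path_word_def)
qed

lemma elem_word_rel:
  assumes "p \<in> fpaths A" "q \<in> fpaths A" "psource p = psource q"
  shows "elem_rel (S_elem A B p k q) =
    {(pushes (pedges q) s, pushes (pedges p) (state_act k s)) | s. state_ok s \<and> state_range s = psource q}"
proof -
  have "elem_rel (S_elem A B p k q) =
      (word_rel (path_word q))\<inverse> O gen_rel (Grp (psource p) k) O word_rel (path_word p)"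
    using assms by (simp add: S_elem_alt elem_rel_class)
      (simp add: elem_word_def word_rel_append word_rel_star O_assoc)
  moreover have "(pushes (pedges q) s, s) \<in> (word_rel (path_word q))\<inverse>"
      "(s, state_act k s) \<in> gen_rel (Grp (psource p) k)"
      "(state_act k s, pushes (pedges p) (state_act k s)) \<in> word_rel (path_word p)"
    if "state_ok s" "state_range s = psource q" for s
    using that assms state_ok_act by (auto simp: path_word_rel)
  ultimately show ?thesis
    using assms by (fastforce simp: path_word_rel)
qed

lemma elem_rel_single_valued:
  assumes "x \<in> gen_words A" "(s, t) \<in> elem_rel (S_class A B x)"
  shows "(s, t') \<in> elem_rel (S_class A B x) \<Longrightarrow> t = t'"
    "(s', t) \<in> elem_rel (S_class A B x) \<Longrightarrow> s = s'"
  using assms by (auto simp: elem_rel_class dest: word_rel_fun word_rel_inj)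

lemma elem_rel_mult_path:
  assumes "x \<in> gen_words A" "p \<in> fpaths A"
  shows "elem_rel (S_mult A B (S_class A B x) (S_class A B (path_word p))) =
    word_rel (path_word p) O elem_rel (S_class A B x)"
proof -
  have "x @ path_word p \<in> gen_words A"
    using assms path_word_gen_words by (auto simp: lists_gen_words)
  then show ?thesis
    using assms by (simp add: S_mult_class elem_rel_class word_rel_append)
qed

lemma cylinder_conc:
  assumes "q \<in> fpaths A"
  shows "w \<in> cylinder A q \<longleftrightarrow> (\<exists>y. y \<in> ipaths A \<and> erange (y 0) = psource q \<and> w = pedges q \<frown> y)"
  using conc_ipaths walk_fpath [OF assms] unfolding cylinder_def by (smt (verit) mem_Collect_eq)

lemma S_acts_elem_rel: "S_acts A B s w z \<Longrightarrow> (Inf w, Inf z) \<in> elem_rel s"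
  unfolding S_acts_def
  by (auto simp: elem_word_rel pushes_Inf)
    (metis pushes_Inf state_act.simps(2) state_ok.simps(2) state_range.simps(2))

lemma germ_pairs_iff:
  "(s, w) \<in> germ_pairs A B \<longleftrightarrow> (\<exists>p k q. p \<in> fpaths A \<and> q \<in> fpaths A \<and> psource p = psource q \<and>
      s = S_elem A B p k q \<and> w \<in> cylinder A q)" (is "?L \<longleftrightarrow> ?R")
proof
  assume ?L
  then obtain p k q y where "p \<in> fpaths A" "q \<in> fpaths A" "psource p = psource q" "s = S_elem A B p k q"
      "y \<in> ipaths A" "erange (y 0) = psource q" "w = pedges q \<frown> y"
    by (auto simp: germ_pairs_def S_acts_def)
  then show ?R
    using cylinder_conc by blast
next
  assume ?R
  then obtain p k q where pq: "p \<in> fpaths A" "q \<in> fpaths A" "psource p = psource q" "s = S_elem A B p k q"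
      and "w \<in> cylinder A q"
    by blast
  then obtain y where "y \<in> ipaths A" "erange (y 0) = psource q" "w = pedges q \<frown> y"
    using cylinder_conc by blast
  then have "S_acts A B s w (pedges p \<frown> ipath_act A B k y)"
    unfolding S_acts_def using pq by blast
  then show ?L
    by (auto simp: germ_pairs_def)
qed

lemma germ_pairs_class:
  assumes "(s, w) \<in> germ_pairs A B"
  obtains x where "x \<in> gen_words A" "s = S_class A B x" "w \<in> ipaths A"
proof -
  obtain p k q where "p \<in> fpaths A" "q \<in> fpaths A" "s = S_elem A B p k q" "w \<in> cylinder A q"
    using assms by (auto simp: germ_pairs_iff)
  then show ?thesis
    using that [of "elem_word p k q"] by (simp add: S_elem_alt cylinder_iff)
qed

lemma S_app_eq:
  assumes "S_acts A B s w z"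
  shows "S_app A B s w = z"
proof -
  have "z' = z" if "S_acts A B s w z'" for z'
  proof -
    have "(s, w) \<in> germ_pairs A B"
      using assms by (auto simp: germ_pairs_def)
    then obtain x where "x \<in> gen_words A" "s = S_class A B x"
      by (rule germ_pairs_class)
    then show ?thesis
      using S_acts_elem_rel [OF assms] S_acts_elem_rel [OF that] elem_rel_single_valued(1) by blast
  qed
  then show ?thesis
    unfolding S_app_def using assms by blast
qed

lemma S_app_elem_rel: "(s, w) \<in> germ_pairs A B \<Longrightarrow> (Inf w, Inf (S_app A B s w)) \<in> elem_rel s"
  using S_acts_elem_rel S_app_eq by (auto simp: germ_pairs_def)

section \<open>Germs\<close>

text \<open>The product \<open>s x\<close>, where \<open>x\<close> is the prefix of \<open>w\<close> of length \<open>n\<close>; two elements have the same germ at \<open>w\<close>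
  if these products agree for some \<open>n\<close>.\<close>

definition restr :: "'n gen list set \<Rightarrow> 'n edge word \<Rightarrow> nat \<Rightarrow> 'n gen list set" where
  "restr s w n = S_mult A B s (S_class A B (path_word (ptake n w)))"

lemma ptake_split:
  assumes "w \<in> ipaths A" "m \<le> n"
  obtains r where "r \<in> fpaths A" "prange r = psource (ptake m w)" "ptake n w = papp (ptake m w) r"
proof -
  let ?r = "ptake (n - m) (suffix m w)"
  have "initial n w = initial m w @ subsequence w m n"
    by (rule initial_split [OF assms(2)])
  then have "ptake n w = papp (ptake m w) ?r"
    using assms by (simp add: ptake_def papp_def)
  moreover have "?r \<in> fpaths A" "prange ?r = psource (ptake m w)"
    using ptake_fpaths(1) [OF suffix_ipaths [OF assms(1)]] assms by (simp_all add: ptake_fpaths(2))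
  ultimately show ?thesis
    using that by blast
qed

text \<open>Multiply both sides on the right by the rest of the longer prefix.\<close>

lemma restr_mono:
  assumes "(s, w) \<in> germ_pairs A B" "(t, w) \<in> germ_pairs A B" "restr s w m = restr t w m" "m \<le> n"
  shows "restr s w n = restr t w n"
proof -
  obtain a where a: "a \<in> gen_words A" "s = S_class A B a" and w: "w \<in> ipaths A"
    using assms(1) by (rule germ_pairs_class)
  obtain b where b: "b \<in> gen_words A" "t = S_class A B b"
    using assms(2) by (rule germ_pairs_class)
  obtain r where r: "r \<in> fpaths A" "prange r = psource (ptake m w)" "ptake n w = papp (ptake m w) r"
    using ptake_split [OF w assms(4)] by blast
  have *: "restr (S_class A B c) w n = S_mult A B (restr (S_class A B c) w m) (S_class A B (path_word r))"
    if "c \<in> gen_words A" for c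
  proof -
    have "c @ path_word (ptake m w) \<in> gen_words A"
      using that path_word_gen_words [OF ptake_fpaths(1) [OF w], of m] by (auto simp: lists_gen_words)
    then show ?thesis
      using that r w S_mult_path_path [of c A "ptake m w" r B]
      by (simp add: restr_def S_mult_class ptake_fpaths(1))
  qed
  show ?thesis
    using *[OF a(1)] *[OF b(1)] assms(3) a b by simp
qed

lemma germ_eq:
  assumes "(s, w) \<in> germ_pairs A B"
  shows "germ A B (s, w) = {(t, w) | t. (t, w) \<in> germ_pairs A B \<and> (\<exists>n. restr s w n = restr t w n)}"
proof -
  have w: "w \<in> ipaths A"
    using assms by (rule germ_pairs_class)
  have "(\<exists>x \<in> fpaths A. w \<in> cylinder A x \<and>
        S_mult A B s (S_class A B (path_word x)) = S_mult A B t (S_class A B (path_word x))) \<longleftrightarrow>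
      (\<exists>n. restr s w n = restr t w n)" for t
    unfolding restr_def using w by (metis cylinder_iff ptake_cylinder ptake_fpaths(1))
  then show ?thesis
    by (auto simp: germ_def)
qed

lemma germ_eq_iff:
  assumes "(s, w) \<in> germ_pairs A B" "(t, z) \<in> germ_pairs A B"
  shows "germ A B (s, w) = germ A B (t, z) \<longleftrightarrow> w = z \<and> (\<exists>n. restr s w n = restr t w n)"
proof
  assume "germ A B (s, w) = germ A B (t, z)"
  moreover have "(t, z) \<in> germ A B (t, z)"
    using assms by (auto simp: germ_eq)
  ultimately show "w = z \<and> (\<exists>n. restr s w n = restr t w n)"
    using assms by (auto simp: germ_eq)
next
  assume wz: "w = z \<and> (\<exists>n. restr s w n = restr t w n)"
  then have "z = w"
    by simp
  obtain n where n: "restr s w n = restr t w n"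
    using wz by blast
  have *: "(\<exists>m. restr s w m = restr u w m) \<longleftrightarrow> (\<exists>m. restr t w m = restr u w m)"
    if "(u, w) \<in> germ_pairs A B" for u
  proof -
    have "restr a w (max m n) = restr b w (max m n)"
      if "restr a w m = restr b w m" "(a, w) \<in> germ_pairs A B" "(b, w) \<in> germ_pairs A B" for a b m
      by (rule restr_mono [OF that(2,3,1)]) simp
    moreover have "restr s w (max m n) = restr t w (max m n)" for m
      by (rule restr_mono [OF _ _ n]) (use assms \<open>z = w\<close> in auto)
    ultimately show ?thesis
      using assms that unfolding \<open>z = w\<close> by metis
  qed
  have "germ A B (t, w) = {(u, w) | u. (u, w) \<in> germ_pairs A B \<and> (\<exists>n. restr t w n = restr u w n)}"
    using assms(2) \<open>z = w\<close> by (simp add: germ_eq)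
  then show "germ A B (s, w) = germ A B (t, z)"
    unfolding germ_eq [OF assms(1)] \<open>z = w\<close> by (simp only: * cong: conj_cong)
qed

text \<open>The range of a germ does not depend on the representative: on \<open>w = x y\<close>, the element \<open>s\<close> acts as
  \<open>s x\<close> acts on \<open>y\<close>.\<close>

lemma restr_S_app:
  assumes "(s, w) \<in> germ_pairs A B" "(t, w) \<in> germ_pairs A B" "restr s w n = restr t w n"
  shows "S_app A B s w = S_app A B t w"
proof -
  obtain a where a: "a \<in> gen_words A" "s = S_class A B a" and w: "w \<in> ipaths A"
    using assms(1) by (rule germ_pairs_class)
  obtain b where b: "b \<in> gen_words A" "t = S_class A B b"
    using assms(2) by (rule germ_pairs_class)
  have x: "ptake n w \<in> fpaths A"
    by (simp add: ptake_fpaths w)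
  have "(Inf (suffix n w), Inf w) \<in> word_rel (path_word (ptake n w))"
    using path_word_rel [OF x] w suffix_ipaths by (auto simp: pushes_Inf ptake_fpaths)
  then have "(Inf (suffix n w), Inf (S_app A B s w)) \<in> elem_rel (restr s w n)"
      "(Inf (suffix n w), Inf (S_app A B t w)) \<in> elem_rel (restr t w n)"
    using S_app_elem_rel [OF assms(1)] S_app_elem_rel [OF assms(2)] a b x
    unfolding restr_def by (auto simp: elem_rel_mult_path)
  moreover have "elem_rel (restr s w n) = elem_rel (S_class A B (a @ path_word (ptake n w)))"
      "a @ path_word (ptake n w) \<in> gen_words A"
    using a x path_word_gen_words [OF x] by (auto simp: restr_def S_mult_class lists_gen_words)
  ultimately show ?thesis
    using assms(3) elem_rel_single_valued(1) by (metis state.inject(2))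
qed

text \<open>This is equality of the germs of \<open>g\<^sup>k\<close> and \<open>g\<^sup>l\<close> at \<open>y\<close>, by \<open>germ_elem_eq_iff\<close> below.\<close>

definition fuse :: "int \<Rightarrow> int \<Rightarrow> 'n edge word \<Rightarrow> bool" where
  "fuse k l y \<longleftrightarrow> (\<exists>n. act k (initial n y) = act l (initial n y) \<and> sect k (initial n y) = sect l (initial n y))"

lemma elem_germ_pairs:
  assumes "p \<in> fpaths A" "x \<in> fpaths A" "psource p = psource x" "w \<in> cylinder A x"
  shows "(S_elem A B p k x, w) \<in> germ_pairs A B"
  using assms by (auto simp: germ_pairs_iff)

lemma ptake_conc:
  assumes "x \<in> fpaths A" "y \<in> ipaths A" "erange (y 0) = psource x"
  shows "ptake (length (pedges x) + n) (pedges x \<frown> y) = papp x (ptake n y)"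
proof -
  have "erange ((pedges x \<frown> y) 0) = prange x"
    using conc_ipaths walk_fpath assms by metis
  then show ?thesis
    by (simp add: ptake_def papp_def)
qed

text \<open>The element \<open>p g\<^sup>k x\<^sup>*\<close> restricted to \<open>x r\<close> is \<open>p (g\<^sup>k\<cdot>r) g\<^sup>k|\<^sub>r\<close>, and the states tell such elements apart. Since
  the action preserves lengths, \<open>p\<close> can be recovered from \<open>p (g\<^sup>k\<cdot>r)\<close>, so that only \<open>k\<close> is left
  undetermined.\<close>

lemma germ_elem_eq_iff:
  assumes "p \<in> fpaths A" "p' \<in> fpaths A" "x \<in> fpaths A" "psource p = psource x" "psource p' = psource x"
    and y: "y \<in> ipaths A" "erange (y 0) = psource x"
  shows "germ A B (S_elem A B p k x, pedges x \<frown> y) = germ A B (S_elem A B p' l x, pedges x \<frown> y) \<longleftrightarrow>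
    p = p' \<and> fuse k l y"
proof -
  let ?w = "pedges x \<frown> y"
  have "?w \<in> cylinder A x"
    using assms cylinder_conc by blast
  then have gp: "(S_elem A B p k x, ?w) \<in> germ_pairs A B" "(S_elem A B p' l x, ?w) \<in> germ_pairs A B"
    using assms elem_germ_pairs by auto
  have restr: "restr (S_elem A B q j x) ?w (length (pedges x) + n) =
      S_class A B (path_word (papp q (fpath_act A B j (ptake n y))) @ [Grp (erange (y n)) (sect j (initial n y))])"
    if "q \<in> fpaths A" "psource q = psource x" for q j n
  proof -
    have n: "ptake n y \<in> fpaths A" "psource (ptake n y) = erange (y n)" "psource x = prange (ptake n y)"
      using ptake_fpaths [OF y(1)] y(2) by simp_all
    show ?thesis
      using S_elem_mult_path [OF that(1) assms(3) n(1) that(2) n(3), of B j]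
      unfolding restr_def ptake_conc [OF assms(3) y] n(2) by simp
  qed
  have rel: "elem_rel (restr (S_elem A B q j x) ?w (length (pedges x) + n)) =
    {(s, pushes (pedges q @ act j (initial n y)) (state_act (sect j (initial n y)) s)) | s.
       state_ok s \<and> state_range s = erange (y n)}"
    if "q \<in> fpaths A" "psource q = psource x" for q j n
  proof -
    let ?z = "papp q (fpath_act A B j (ptake n y))"
    have z: "?z \<in> fpaths A" "psource ?z = erange (y n)"
      using that assms by (auto simp: papp_fpath fpath_act_fpaths ptake_fpaths)
    then have "path_word ?z @ [Grp (erange (y n)) (sect j (initial n y))] \<in> gen_words A"
      using path_word_gen_words by (auto simp: lists_gen_words)
    then have "elem_rel (restr (S_elem A B q j x) ?w (length (pedges x) + n)) =
        gen_rel (Grp (erange (y n)) (sect j (initial n y))) O word_rel (path_word ?z)"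
      unfolding restr [OF that] by (simp add: elem_rel_class word_rel_append)
    also have "pedges ?z = pedges q @ act j (initial n y)"
      by (simp add: papp_def fpath_act_def)
    ultimately show ?thesis
      using z state_ok_act by (auto simp: path_word_rel)
  qed
  show ?thesis
  proof
    assume "germ A B (S_elem A B p k x, ?w) = germ A B (S_elem A B p' l x, ?w)"
    then obtain m where "restr (S_elem A B p k x) ?w m = restr (S_elem A B p' l x) ?w m"
      using germ_eq_iff [OF gp] by blast
    then obtain n where n: "restr (S_elem A B p k x) ?w (length (pedges x) + n) = restr (S_elem A B p' l x) ?w (length (pedges x) + n)"
      using restr_mono [OF gp] by (metis le_add2)
    let ?v = "erange (y n)" and ?y = "initial n y"
    have "pushes (pedges q @ act j ?y) (state_act (sect j ?y) (Fin ?v [] 0)) =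
        Fin (prange q) (pedges q @ act j ?y) (sect j ?y)" if "q \<in> fpaths A" "psource q = psource x" for q j
    proof -
      have "walk A (prange q) (pedges q @ act j ?y) ?v"
        using walk_fpath [OF that(1)] walk_act [OF walk_ipath [OF y(1)]] that y(2) by (auto simp: walk_append)
      then show ?thesis
        by (simp add: pushes_Fin)
    qed
    then have *: "(Fin ?v [] 0, Fin (prange q) (pedges q @ act j ?y) (sect j ?y)) \<in>
       elem_rel (restr (S_elem A B q j x) ?w (length (pedges x) + n))" if "q \<in> fpaths A" "psource q = psource x" for q j
      unfolding rel [OF that] using that by force
    \<comment> \<open>Both elements send the state of the trivial path to a state that displays the whole element.\<close>
    have "(Fin ?v [] 0, Fin (prange p') (pedges p' @ act l ?y) (sect l ?y)) \<in>
       elem_rel (restr (S_elem A B p k x) ?w (length (pedges x) + n))"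
      unfolding n by (rule *[OF assms(2,5)])
    with *[OF assms(1,4), of k] have
      "Fin (prange p') (pedges p' @ act l ?y) (sect l ?y) = Fin (prange p) (pedges p @ act k ?y) (sect k ?y)"
      unfolding rel [OF assms(1,4)] by auto
    moreover from this have "length (pedges p) = length (pedges p')"
      by (metis add_right_cancel length_act length_append state.inject(1))
    ultimately show "p = p' \<and> fuse k l y"
      by (auto simp: fuse_def intro!: fpath.expand) metis
  next
    assume *: "p = p' \<and> fuse k l y"
    then obtain n where "act k (initial n y) = act l (initial n y)" "sect k (initial n y) = sect l (initial n y)"
      by (auto simp: fuse_def)
    then have "restr (S_elem A B p k x) ?w (length (pedges x) + n) = restr (S_elem A B p' l x) ?w (length (pedges x) + n)"
      using restr assms * by (simp add: fpath_act_def)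
    then show "germ A B (S_elem A B p k x, ?w) = germ A B (S_elem A B p' l x, ?w)"
      using germ_eq_iff [OF gp] by blast
  qed
qed

lemma germ_normal_form:
  assumes "(s, w) \<in> germ_pairs A B"
  obtains N where "\<And>n. n \<ge> N \<Longrightarrow> \<exists>p k. p \<in> fpaths A \<and> psource p = psource (ptake n w) \<and>
    (\<forall>w' \<in> cylinder A (ptake n w). (s, w') \<in> germ_pairs A B \<and>
       germ A B (s, w') = germ A B (S_elem A B p k (ptake n w), w'))"
proof -
  obtain p k q where pq: "p \<in> fpaths A" "q \<in> fpaths A" "psource p = psource q"
      "s = S_elem A B p k q" and w: "w \<in> cylinder A q"
    using assms by (auto simp: germ_pairs_iff)
  have wi: "w \<in> ipaths A" and q: "ptake (length (pedges q)) w = q"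
    using w pq by (auto simp: cylinder_iff)
  show ?thesis
  proof
    fix n assume n: "n \<ge> length (pedges q)"
    obtain r where r: "r \<in> fpaths A" "prange r = psource q" "ptake n w = papp q r"
      using ptake_split [OF wi n] q by auto
    let ?P = "papp p (fpath_act A B k r)" and ?K = "sect k (pedges r)"
    have P: "?P \<in> fpaths A" "psource ?P = psource (ptake n w)"
      using pq r by (auto simp: papp_fpath fpath_act_fpaths)
    have "(s, w') \<in> germ_pairs A B \<and> germ A B (s, w') = germ A B (S_elem A B ?P ?K (ptake n w), w')"
      if w': "w' \<in> cylinder A (ptake n w)" for w'
    proof -
      have w'i: "w' \<in> ipaths A" and eq: "ptake n w' = ptake n w"
        using w' wi by (auto simp: cylinder_ptake_iff)
      have "w' \<in> cylinder A q"
        using ptake_mono [OF eq n] q w'i pq by (simp add: cylinder_iff)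
      then have gp: "(s, w') \<in> germ_pairs A B"
        using pq by (auto simp: germ_pairs_iff)
      have gp': "(S_elem A B ?P ?K (ptake n w), w') \<in> germ_pairs A B"
        using P w' wi by (auto intro!: elem_germ_pairs ptake_fpaths)
      have "restr s w' n = restr (S_elem A B ?P ?K (ptake n w)) w' n"
        using S_elem_extend [OF pq(1,2) r(1) pq(3), of k] r pq(4) eq by (simp add: restr_def)
      then show ?thesis
        using gp gp' germ_eq_iff by blast
    qed
    then show "\<exists>p k. p \<in> fpaths A \<and> psource p = psource (ptake n w) \<and>
      (\<forall>w' \<in> cylinder A (ptake n w). (s, w') \<in> germ_pairs A B \<and>
       germ A B (s, w') = germ A B (S_elem A B p k (ptake n w), w'))"
      using P by blast
  qed
qed

end

section \<open>Fusion of group elements along a path\<close>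

context katsura
begin

abbreviation nz :: "'n edge \<Rightarrow> bool" where
  "nz e \<equiv> B $ erange e $ esource e \<noteq> 0"

lemma path_weight_nonzero_iff: "path_weight B p \<noteq> 0 \<longleftrightarrow> (\<forall>e \<in> set (pedges p). nz e)"
  by (auto simp: path_weight_def prod_list_zero_iff)

text \<open>Quotient and remainder determine \<open>k b + r\<close>, and if \<open>b \<noteq> 0\<close> then also \<open>k\<close>.\<close>

lemma edge_inject:
  assumes "edge_act A B k e = edge_act A B l e" "edge_section A B k e = edge_section A B l e" "nz e"
  shows "k = l"
proof -
  let ?a = "A $ erange e $ esource e" and ?b = "B $ erange e $ esource e"
  have "(k * ?b + eindex e) mod ?a = (l * ?b + eindex e) mod ?a"
      "(k * ?b + eindex e) div ?a = (l * ?b + eindex e) div ?a"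
    using assms(1,2) by (auto simp: edge_act_def edge_section_def)
  then have "k * ?b + eindex e = l * ?b + eindex e"
    by (metis mult_div_mod_eq)
  then show ?thesis
    using assms(3) by simp
qed

lemma walk_inject:
  assumes "\<forall>e \<in> set es. nz e" "act k es = act l es" "sect k es = sect l es"
  shows "k = l"
  using assms
proof (induction es arbitrary: k l)
  case (Cons e es)
  then have "edge_section A B k e = edge_section A B l e"
    by simp
  then show ?case
    using Cons.prems edge_inject by simp
qed simp

text \<open>If \<open>b = 0\<close> then the quotient of \<open>k b + r = r\<close> by \<open>a > r\<close> is \<open>0\<close>, whatever \<open>k\<close> is, and the trivial
  element has trivial sections from there on.\<close>

lemma sect_weight_zero:
  "walk A u es v \<Longrightarrow> \<exists>e \<in> set es. \<not> nz e \<Longrightarrow> sect k es = 0"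
proof (induction es arbitrary: u k)
  case (Cons e es)
  show ?case
  proof (cases "nz e")
    case True
    then show ?thesis
      using Cons by auto
  next
    case False
    then have "edge_section A B k e = 0"
      using Cons.prems by (auto simp: edge_section_def edges_def)
    then show ?thesis
      using Cons.prems sect_zero by auto
  qed
qed simp

lemma act_prefix:
  assumes "act k (xs @ ys) = act l (xs @ ys)"
  shows "act k xs = act l xs"
  using assms by (simp add: act_append)

text \<open>After an edge of weight zero all sections are trivial. So whether two group elements fuse is decided by
  any prefix that contains such an edge: fusion is locally constant there.\<close>

lemma fuse_weight_zero:
  assumes "y \<in> ipaths A" "\<exists>e \<in> set (initial m y). \<not> nz e"
  shows "fuse k l y \<longleftrightarrow> act k (initial m y) = act l (initial m y)"
proof
  assume "fuse k l y"
  then obtain n where n: "act k (initial n y) = act l (initial n y)" "sect k (initial n y) = sect l (initial n y)"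
    by (auto simp: fuse_def)
  show "act k (initial m y) = act l (initial m y)"
  proof (cases "m \<le> n")
    case True
    then show ?thesis
      using n(1) act_prefix initial_split by metis
  next
    case False
    then have "initial m y = initial n y @ subsequence y n m"
      by (intro initial_split) simp
    then show ?thesis
      using n by (simp add: act_append)
  qed
next
  assume "act k (initial m y) = act l (initial m y)"
  moreover have "sect k (initial m y) = sect l (initial m y)"
    using sect_weight_zero [OF walk_ipath [OF assms(1)] assms(2)] by simp
  ultimately show "fuse k l y"
    by (auto simp: fuse_def)
qed

lemma fuse_weight_nonzero:
  assumes "\<And>i. nz (y i)"
  shows "fuse k l y \<longleftrightarrow> k = l"
  using walk_inject [of "initial n y" k l for n] assms by (auto simp: fuse_def)

lemma act_eq_iff:
  assumes "walk A u es v"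
  shows "act k es = act l es \<longleftrightarrow> act (k - l) es = es"
proof
  assume "act k es = act l es"
  then have "act (- l + k) es = act (- l + l) es"
    using act_add [OF assms] by metis
  then show "act (k - l) es = es"
    using act_zero [OF assms] by simp
next
  assume "act (k - l) es = es"
  then show "act k es = act l es"
    using act_add [OF assms, of l "k - l"] by simp
qed

lemma act_fixed_dvd:
  assumes "walk A u es v" "act d es = es" "d dvd m"
  shows "act m es = es"
proof -
  have nat: "act (d * int n) es = es" for n
    using act_add [OF assms(1), of d] act_zero [OF assms(1)] assms(2)
    by (induction n) (simp_all add: distrib_left)
  obtain j where j: "m = d * j"
    using assms(3) by blast
  show ?thesis
  proof (cases "j \<ge> 0")
    case True
    then show ?thesis
      using nat [of "nat j"] j by simp
  next
    case False
    then have "act (- m) es = es"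
      using nat [of "nat (- j)"] j by simp
    then show ?thesis
      using act_eq_iff [OF assms(1), of 0 m] act_zero [OF assms(1)] by simp
  qed
qed

lemma fpath_act_fixed_iff: "fpath_act A B k p = p \<longleftrightarrow> act k (pedges p) = pedges p"
  by (cases p) (simp add: fpath_act_def)

text \<open>The group elements fixing a given path form a subgroup of \<open>\<int>\<close>. If every path were fixed by a member of
  the finite set \<open>D\<close>, then the product of \<open>D\<close>, which all members divide, would fix every path.\<close>

lemma faithful_separates:
  assumes "acts_faithfully A B v" "finite D" "0 \<notin> D"
  shows "\<exists>es u. walk A v es u \<and> (\<forall>d \<in> D. act d es \<noteq> es)"
proof (rule ccontr)
  assume *: "\<not> ?thesis"
  have "fpath_act A B (\<Prod>D) p = p" if "p \<in> fpaths_from A v" for p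
  proof -
    have w: "walk A v (pedges p) (psource p)"
      using that walk_fpath by (auto simp: fpaths_from_def)
    then obtain d where "d \<in> D" "act d (pedges p) = pedges p"
      using * that by blast
    then show ?thesis
      using act_fixed_dvd [OF w] dvd_prodI [of D d "\<lambda>d. d"] assms(2) by (simp add: fpath_act_fixed_iff)
  qed
  then have "\<Prod>D = 0"
    using assms(1) by (auto simp: acts_faithfully_def)
  then show False
    using assms by (simp add: prod_zero_iff)
qed

section \<open>Paths of nonzero weight\<close>

lemma cycle_iter:
  assumes "is_cycle A c"
  shows "(pedges c)\<^sup>\<omega> \<in> ipaths A" "erange ((pedges c)\<^sup>\<omega> 0) = prange c"
proof -
  let ?n = "length (pedges c)"
  have n: "?n > 0" and c: "c \<in> fpaths A" "prange c = psource c"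
    using assms by (auto simp: is_cycle_def)
  have hd: "erange (pedges c ! 0) = prange c"
    using c n by (simp add: fpaths_def hd_conv_nth)
  have "esource (pedges c ! (i mod ?n)) = erange (pedges c ! (Suc i mod ?n))" for i
  proof (cases "Suc (i mod ?n) = ?n")
    case True
    then have "pedges c ! (i mod ?n) = last (pedges c)"
      using n by (metis diff_Suc_1 last_conv_nth length_greater_0_conv)
    then have "esource (pedges c ! (i mod ?n)) = prange c"
      using c n by (simp add: psource_def)
    moreover have "Suc i mod ?n = 0"
      using True by (simp add: mod_Suc)
    ultimately show ?thesis
      using hd by simp
  next
    case False
    then have "Suc i mod ?n = Suc (i mod ?n)"
      by (simp add: mod_Suc)
    moreover have "Suc (i mod ?n) < ?n"
      using False n mod_less_divisor [OF n, of i] by linarith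
    ultimately show ?thesis
      using c by (simp add: fpaths_def)
  qed
  moreover have "pedges c ! (i mod ?n) \<in> edges A" for i
    using c n by (auto simp: fpaths_def)
  ultimately show "(pedges c)\<^sup>\<omega> \<in> ipaths A"
    using n by (simp add: ipaths_def)
  show "erange ((pedges c)\<^sup>\<omega> 0) = prange c"
    using n hd by simp
qed

lemma nonzero_ipath_of_cycle:
  assumes "r \<in> fpaths_from A v" "is_cycle A c" "prange c = psource r" "path_weight B (papp r c) \<noteq> 0"
  obtains y where "y \<in> ipaths A" "erange (y 0) = v" "\<And>i. nz (y i)"
proof
  let ?y = "pedges r \<frown> (pedges c)\<^sup>\<omega>"
  have "walk A v (pedges r) (erange ((pedges c)\<^sup>\<omega> 0))"
    using assms walk_fpath cycle_iter(2) [OF assms(2)] by (auto simp: fpaths_from_def)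
  then show "?y \<in> ipaths A" "erange (?y 0) = v"
    using conc_ipaths cycle_iter(1) [OF assms(2)] by blast+
  have nz: "\<forall>e \<in> set (pedges r) \<union> set (pedges c). nz e"
    using assms(4) by (auto simp: path_weight_nonzero_iff papp_def)
  have "length (pedges c) > 0"
    using assms(2) by (auto simp: is_cycle_def)
  then have "?y i \<in> set (pedges r) \<union> set (pedges c)" for i
    by (cases "i < length (pedges r)") auto
  then show "nz (?y i)" for i
    using nz by blast
qed

lemma subseq_imp_subset: "subseq xs ys \<Longrightarrow> set xs \<subseteq> set ys"
  by (auto elim: list_emb_set)

text \<open>A cycle that is a subsequence of a path need not be contiguous in it, but its first and last edge bound a
  contiguous segment that is again closed.\<close>

lemma subseq_Cons_segment:
  assumes "subseq (e # es) xs"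
  obtains as bs cs where "xs = as @ bs @ cs" "bs \<noteq> []" "hd bs = e" "last bs = last (e # es)"
proof -
  obtain us vs where uv: "xs = us @ e # vs" "subseq es vs"
    using assms by (auto dest: list_emb_ConsD)
  show ?thesis
  proof (cases "es = []")
    case True
    then show ?thesis
      using that [of us "[e]" vs] uv by simp
  next
    case False
    then have "last es \<in> set vs"
      using subseq_imp_subset [OF uv(2)] last_in_set by blast
    then obtain ms cs where "vs = ms @ last es # cs"
      by (meson split_list)
    then show ?thesis
      using that [of us "e # ms @ [last es]" cs] uv False by simp
  qed
qed

text \<open>Some vertex is visited twice, which gives a path leading to a cycle. Choose such a pair with the cycle
  as short as possible and, for this cycle, with the path as short as possible. Both are
  simple by minimality: a cycle \<open>d\<close> inside \<open>c\<close> is reached through the part of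
  \<open>c\<close> before the first edge of \<open>d\<close>, and a cycle inside \<open>r\<close> bounds a segment that can be cut out of \<open>r\<close>.\<close>

lemma simple_cycle_of_nonzero_ipath:
  assumes y: "y \<in> ipaths A" "erange (y 0) = v" and nz: "\<And>i. nz (y i)"
  obtains r c where "r \<in> fpaths_from A v" "simple_fpath A r" "simple_cycle A c"
    "prange c = psource r" "path_weight B (papp r c) \<noteq> 0"
proof -
  define good where "good r c \<longleftrightarrow> r \<in> fpaths_from A v \<and> is_cycle A c \<and> prange c = psource r \<and>
    (\<forall>e \<in> set (pedges r) \<union> set (pedges c). nz e)" for r c
  have "\<not> inj (\<lambda>i. erange (y i))"
    using finite_imageD [of "\<lambda>i. erange (y i)" UNIV] by auto
  then obtain i j where ij: "i < j" "erange (y i) = erange (y j)"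
    unfolding inj_def by (metis linorder_neqE_nat)
  have "good (ptake i y) (ptake (j - i) (suffix i y))"
    using ij y nz ptake_fpaths [OF y(1)] ptake_fpaths [OF suffix_ipaths [OF y(1)]]
    by (auto simp: good_def fpaths_from_def is_cycle_def)
  then obtain c where c: "\<exists>r. good r c" and cmin: "\<And>d. \<exists>r. good r d \<Longrightarrow> length (pedges c) \<le> length (pedges d)"
    using ex_has_least_nat [of "\<lambda>c. \<exists>r. good r c" _ "\<lambda>c. length (pedges c)"] by blast
  then obtain r where r: "good r c" and rmin: "\<And>r'. good r' c \<Longrightarrow> length (pedges r) \<le> length (pedges r')"
    using ex_has_least_nat [of "\<lambda>r. good r c" _ "\<lambda>r. length (pedges r)"] by blast
  have rw: "walk A v (pedges r) (psource r)" and cw: "walk A (psource r) (pedges c) (psource r)"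
    and cyc: "is_cycle A c" and rc: "prange c = psource r"
    and nzr: "\<forall>e \<in> set (pedges r). nz e" and nzc: "\<forall>e \<in> set (pedges c). nz e"
    using r walk_fpath [of r A] walk_fpath [of c A] by (auto simp: good_def fpaths_from_def is_cycle_def)
  have "\<not> (is_cycle A d \<and> strict_subseq (pedges d) (pedges c))" for d
  proof
    assume d: "is_cycle A d \<and> strict_subseq (pedges d) (pedges c)"
    then obtain e es where e: "pedges d = e # es"
      by (auto simp: is_cycle_def neq_Nil_conv)
    have "prange d = erange e"
      using d e by (auto simp: is_cycle_def fpaths_def)
    have sub: "set (pedges d) \<subseteq> set (pedges c)"
      using d by (auto dest: subseq_imp_subset simp: strict_subseq_def)
    then obtain as bs where c_eq: "pedges c = as @ e # bs"
      using e by (auto dest: split_list)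
    then have as: "walk A (psource r) as (erange e)"
      using cw by (auto simp: walk_append)
    have "walk A v (pedges r @ as) (erange e)"
      using as rw by (auto simp: walk_append)
    then have "good (FPath v (pedges r @ as)) d"
      using nzr nzc sub c_eq d \<open>prange d = erange e\<close>
      by (auto simp: good_def fpaths_from_def FPath_fpaths_iff walk_psource)
    moreover have "length (pedges d) < length (pedges c)"
      using d by (metis list_emb_length order_le_less subseq_same_length strict_subseq_def)
    ultimately show False
      using cmin [of d] by force
  qed
  then have "simple_cycle A c"
    using cyc by (auto simp: simple_cycle_def)
  moreover have "\<not> (is_cycle A d \<and> subseq (pedges d) (pedges r))" for d
  proof
    assume d: "is_cycle A d \<and> subseq (pedges d) (pedges r)"
    then obtain e es where e: "pedges d = e # es"
      by (auto simp: is_cycle_def neq_Nil_conv)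
    then obtain as bs cs where s: "pedges r = as @ bs @ cs" "bs \<noteq> []" "hd bs = e" "last bs = last (pedges d)"
      using d subseq_Cons_segment [of e es "pedges r"] by metis
    have "esource (last bs) = erange e"
      using d e s(4) by (auto simp: is_cycle_def fpaths_def psource_def)
    obtain u w where w: "walk A v as u" "walk A u bs w" "walk A w cs (psource r)"
      using rw s(1) by (auto simp: walk_append)
    have "u = erange e"
      using w(2) s(2,3) by (cases bs) auto
    moreover have "w = esource (last bs)"
      using walk_psource [OF w(2)] s(2) by (simp add: psource_def)
    ultimately have "walk A v (as @ cs) (psource r)"
      using w \<open>esource (last bs) = erange e\<close> by (auto simp: walk_append)
    then have "good (FPath v (as @ cs)) c"
      using nzr nzc s(1) cyc rc by (auto simp: good_def fpaths_from_def FPath_fpaths_iff walk_psource)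
    then show False
      using rmin [of "FPath v (as @ cs)"] s by simp
  qed
  ultimately show ?thesis
    using that [of r c] r by (auto simp: good_def simple_fpath_def fpaths_from_def path_weight_nonzero_iff papp_def)
qed

section \<open>Class sums\<close>

text \<open>The value at the germ \<open>[g\<^sup>k, y]\<close> of the linear combination, with
  coefficients \<open>b\<close>, of the indicator functions of the bisections of \<open>g\<^sup>l\<close>, \<open>l \<in> D\<close>.\<close>

definition class_sum :: "int set \<Rightarrow> (int \<Rightarrow> 'k::field) \<Rightarrow> int \<Rightarrow> 'n edge word \<Rightarrow> 'k" where
  "class_sum D b k y = (\<Sum>l | l \<in> D \<and> fuse k l y. b l)"

text \<open>The combinatorial core of the direction from a singular element to the conditions on \<open>v\<close>. The
  hypothesis \<open>vanish\<close> is what singularity gives: no basic open set of germs avoids the zeros of the function. Over paths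
  meeting an edge of weight zero the class sums are locally constant, so they vanish there. Over paths of nonzero
  weight no two exponents fuse, so the class sum at \<open>k\<^sub>0\<close> is the single coefficient \<open>b k\<^sub>0 \<noteq> 0\<close>. Therefore
  the paths of nonzero weight contain \<open>y\<^sub>0\<close> but no cylinder. If \<open>v\<close> acted faithfully, a path could be
  chosen that separates \<open>k\<^sub>0\<close> from the rest of \<open>D\<close> and then meets weight zero; the class sum at \<open>k\<^sub>0\<close>
  there would again be \<open>b k\<^sub>0\<close>, but also zero.\<close>

lemma class_sum_vanishing:
  assumes D: "finite D" and y0: "y0 \<in> ipaths A" "erange (y0 0) = v"
    and nonzero: "class_sum D b k0 y0 \<noteq> 0"
    and vanish: "\<And>k es u. walk A v es u \<Longrightarrow>
       \<exists>y. y \<in> ipaths A \<and> erange (y 0) = v \<and> initial (length es) y = es \<and> class_sum D b k y = 0"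
  shows "\<forall>p \<in> fpaths_from A v. \<exists>q \<in> fpaths_from A (psource p). path_weight B (papp p q) = 0" (is ?T2)
    and "\<And>i. nz (y0 i)" and "\<not> acts_faithfully A B v"
proof -
  have zero: "class_sum D b k y = 0" if y: "y \<in> ipaths A" "erange (y 0) = v" "\<not> nz (y i)" for k y i
  proof -
    let ?es = "initial (Suc i) y"
    have nz: "\<exists>e \<in> set ?es. \<not> nz e"
      using y(3) by auto
    obtain z where z: "z \<in> ipaths A" "initial (Suc i) z = ?es" "class_sum D b k z = 0"
      using vanish [of ?es _ k] walk_ipath [OF y(1)] y(2) by (metis diff_zero subsequence_length)
    have "fuse k l y \<longleftrightarrow> fuse k l z" for l
      using fuse_weight_zero [OF y(1) nz] fuse_weight_zero [OF z(1), of "Suc i"] nz z(2) by simp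
    then show ?thesis
      using z(3) by (simp add: class_sum_def)
  qed
  show nz0: "nz (y0 i)" for i
    using zero y0 nonzero by blast
  have single: "class_sum D b k0 y = (if k0 \<in> D then b k0 else 0)"
    if "\<And>l. l \<in> D \<Longrightarrow> fuse k0 l y \<longleftrightarrow> k0 = l" for y
  proof -
    have "{l. l \<in> D \<and> fuse k0 l y} = (if k0 \<in> D then {k0} else {})"
      using that by auto
    then show ?thesis
      by (simp add: class_sum_def)
  qed
  from single [OF fuse_weight_nonzero [OF nz0]] have b: "(if k0 \<in> D then b k0 else 0) \<noteq> 0"
    using nonzero by simp
  show T2: ?T2
  proof (rule ccontr)
    assume "\<not> ?T2"
    then obtain p where p: "p \<in> fpaths_from A v"
      and nzp: "\<And>q. q \<in> fpaths_from A (psource p) \<Longrightarrow> path_weight B (papp p q) \<noteq> 0"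
      by blast
    let ?n = "length (pedges p)"
    have "walk A v (pedges p) (psource p)"
      using p walk_fpath by (auto simp: fpaths_from_def)
    then obtain y where y: "y \<in> ipaths A" "erange (y 0) = v" "initial ?n y = pedges p" "class_sum D b k0 y = 0"
      using vanish by blast
    have "nz (y i)" for i
    proof -
      have "psource p = erange (y ?n)"
        using ptake_fpaths(2) [OF y(1), of ?n] y(2,3) p by (cases p) (simp add: ptake_def fpaths_from_def)
      then have "ptake (Suc i) (suffix ?n y) \<in> fpaths_from A (psource p)"
        using ptake_fpaths [OF suffix_ipaths [OF y(1)]] by (simp add: fpaths_from_def)
      then have "\<forall>e \<in> set (pedges p) \<union> set (initial (Suc i) (suffix ?n y)). nz e"
        using nzp by (fastforce simp: path_weight_nonzero_iff papp_def)
      moreover have "y i \<in> set (pedges p) \<union> set (initial (Suc i) (suffix ?n y))"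
      proof (cases "i < ?n")
        case True
        then have "y i \<in> set (initial ?n y)"
          by auto
        then show ?thesis
          using y(3) by simp
      next
        case False
        then have "y i \<in> y ` {?n..<?n + Suc i}"
          by simp
        moreover have "set (initial (Suc i) (suffix ?n y)) = y ` {?n..<?n + Suc i}"
          by (simp del: subseq_to_Suc)
        ultimately show ?thesis
          by blast
      qed
      ultimately show ?thesis
        by blast
    qed
    from single [OF fuse_weight_nonzero [OF this]] show False
      using y(4) b by simp
  qed
  show "\<not> acts_faithfully A B v"
  proof
    assume "acts_faithfully A B v"
    moreover have "finite ((\<lambda>l. k0 - l) ` (D - {k0}))" "0 \<notin> (\<lambda>l. k0 - l) ` (D - {k0})"
      using D by auto
    ultimately obtain es u where es: "walk A v es u"
      and sep: "\<And>d. d \<in> (\<lambda>l. k0 - l) ` (D - {k0}) \<Longrightarrow> act d es \<noteq> es"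
      using faithful_separates [of v "(\<lambda>l. k0 - l) ` (D - {k0})"] by blast
    have "FPath v es \<in> fpaths_from A v" "psource (FPath v es) = u"
      using es by (auto simp: fpaths_from_def FPath_fpaths_iff walk_psource)
    then obtain q where q: "q \<in> fpaths_from A u" "path_weight B (papp (FPath v es) q) = 0"
      using T2 by metis
    let ?z = "es @ pedges q"
    have nz: "\<exists>e \<in> set ?z. \<not> nz e"
      using q(2) path_weight_nonzero_iff [of "papp (FPath v es) q"] by (auto simp: papp_def)
    have "walk A u (pedges q) (psource q)"
      using q(1) walk_fpath by (auto simp: fpaths_from_def)
    then have z: "walk A v ?z (psource q)"
      using es by (auto simp: walk_append)
    then obtain y where y: "y \<in> ipaths A" "initial (length ?z) y = ?z" "class_sum D b k0 y = 0"
      using vanish by metis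
    have "fuse k0 l y \<longleftrightarrow> k0 = l" if "l \<in> D" for l
    proof -
      have "fuse k0 l y \<longleftrightarrow> act k0 ?z = act l ?z"
        by (rule fuse_weight_zero [OF y(1), of "length ?z", unfolded y(2), OF nz])
      moreover have "act k0 es \<noteq> act l es" if "k0 \<noteq> l"
        using sep [of "k0 - l"] that \<open>l \<in> D\<close> act_eq_iff [OF es] by auto
      ultimately show ?thesis
        using act_prefix by blast
    qed
    from single [OF this] show False
      using y(3) b by simp
  qed
qed

end

section \<open>The space of infinite paths\<close>

lemma cylinder_mono:
  assumes "w \<in> ipaths M" "m \<le> n"
  shows "cylinder M (ptake n w) \<subseteq> cylinder M (ptake m w)"
  using assms ptake_mono by (auto simp: cylinder_ptake_iff)

lemma cylinder_subset_ipaths: "x \<in> fpaths M \<Longrightarrow> cylinder M x \<subseteq> ipaths M"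
  by (auto simp: cylinder_iff)

lemma openin_ipath_topology:
  "openin (ipath_topology M) D \<longleftrightarrow>
     D \<subseteq> ipaths M \<and> (\<forall>w \<in> D. \<exists>n. cylinder M (ptake n w) \<subseteq> D)"
proof
  assume "openin (ipath_topology M) D"
  then have "generate_topology_on (cylinder M ` fpaths M) D"
    by (simp add: ipath_topology_def openin_topology_generated_by_iff)
  then show "D \<subseteq> ipaths M \<and> (\<forall>w \<in> D. \<exists>n. cylinder M (ptake n w) \<subseteq> D)"
  proof induction
    case (Int a b)
    have "\<exists>n. cylinder M (ptake n w) \<subseteq> a \<inter> b" if wab: "w \<in> a" "w \<in> b" for w
    proof -
      have w: "w \<in> ipaths M"
        using wab Int.IH by blast
      obtain m where "cylinder M (ptake m w) \<subseteq> a"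
        using wab Int.IH by blast
      moreover obtain n where "cylinder M (ptake n w) \<subseteq> b"
        using wab Int.IH by blast
      ultimately have "cylinder M (ptake (max m n) w) \<subseteq> a \<inter> b"
        using cylinder_mono [OF w, of m "max m n"] cylinder_mono [OF w, of n "max m n"] by auto
      then show ?thesis ..
    qed
    then show ?case
      using Int.IH by blast
  next
    case (UN K)
    then show ?case
      by (meson Sup_least UnionE Union_upper subset_trans)
  next
    case (Basis s)
    then obtain x where "x \<in> fpaths M" "s = cylinder M x"
      by blast
    then show ?case
      by (metis cylinder_iff subsetI order_refl)
  qed simp
next
  assume D: "D \<subseteq> ipaths M \<and> (\<forall>w \<in> D. \<exists>n. cylinder M (ptake n w) \<subseteq> D)"
  show "openin (ipath_topology M) D"
  proof (subst openin_subopen, intro ballI)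
    fix w assume w: "w \<in> D"
    then obtain n where "cylinder M (ptake n w) \<subseteq> D"
      using D by blast
    moreover have "openin (ipath_topology M) (cylinder M (ptake n w))"
      unfolding ipath_topology_def using D w by (intro topology_generated_by_Basis imageI ptake_fpaths) blast
    moreover have "w \<in> cylinder M (ptake n w)"
      using D w ptake_cylinder by blast
    ultimately show "\<exists>T. openin (ipath_topology M) T \<and> w \<in> T \<and> T \<subseteq> D"
      by blast
  qed
qed

lemma topspace_ipath_topology [simp]: "topspace (ipath_topology M) = ipaths M"
  by (metis openin_ipath_topology cylinder_subset_ipaths openin_subset openin_topspace
      ptake_fpaths(1) subset_antisym order_refl)

lemma openin_cylinder: "x \<in> fpaths M \<Longrightarrow> openin (ipath_topology M) (cylinder M x)"
  unfolding ipath_topology_def by (intro topology_generated_by_Basis imageI)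

lemma Hausdorff_ipath_topology: "Hausdorff_space (ipath_topology M)"
  unfolding Hausdorff_space_def
proof (intro allI impI)
  fix w w' assume w: "w \<in> topspace (ipath_topology M) \<and> w' \<in> topspace (ipath_topology M) \<and> w \<noteq> w'"
  then obtain i where i: "w i \<noteq> w' i"
    by auto
  let ?C = "\<lambda>w. cylinder M (ptake (Suc i) w)"
  have "initial (Suc i) w ! i \<noteq> initial (Suc i) w' ! i"
    using i by (simp del: subseq_to_Suc)
  then have "ptake (Suc i) w \<noteq> ptake (Suc i) w'"
    by (metis pedges_ptake)
  then have "disjnt (?C w) (?C w')"
    using w by (auto simp: disjnt_iff cylinder_ptake_iff)
  then show "\<exists>U V. openin (ipath_topology M) U \<and> openin (ipath_topology M) V \<and> w \<in> U \<and> w' \<in> V \<and> disjnt U V"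
    using w by (intro exI [of _ "?C w"] exI [of _ "?C w'"])
      (auto simp: openin_cylinder ptake_fpaths ptake_cylinder)
qed

definition snoc_path :: "'n fpath \<Rightarrow> 'n edge \<Rightarrow> 'n fpath" where
  "snoc_path x e = FPath (prange x) (pedges x @ [e])"

lemma cylinder_snoc:
  assumes "x \<in> fpaths M" "w \<in> cylinder M x"
  obtains e where "e \<in> edges M" "erange e = psource x" "w \<in> cylinder M (snoc_path x e)"
proof
  let ?n = "length (pedges x)"
  have w: "w \<in> ipaths M" "ptake ?n w = x"
    using assms by (auto simp: cylinder_iff)
  show "w ?n \<in> edges M"
    using w by (simp add: ipaths_def)
  show "erange (w ?n) = psource x"
    using ptake_fpaths(2) [OF w(1), of ?n] w(2) by simp
  have "snoc_path x (w ?n) = ptake (Suc ?n) w"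
    using w(2) by (metis le0 pedges_ptake prange_ptake ptake_def snoc_path_def subseq_to_Suc)
  then show "w \<in> cylinder M (snoc_path x (w ?n))"
    using w ptake_cylinder by metis
qed

text \<open>Koenig's lemma: if a cylinder has no finite subcover, neither has one of the finitely many cylinders
  of one edge more. Iterating produces an infinite path, and a member of the cover around it contains one of
  these cylinders.\<close>

lemma compactin_cylinder:
  fixes M :: "int^'n^'n"
  assumes "x \<in> fpaths M"
  shows "compactin (ipath_topology M) (cylinder M x)"
  unfolding compactin_def
proof (intro conjI allI impI)
  show "cylinder M x \<subseteq> topspace (ipath_topology M)"
    using assms cylinder_subset_ipaths by simp
next
  fix \<U> assume \<U>: "(\<forall>U\<in>\<U>. openin (ipath_topology M) U) \<and> cylinder M x \<subseteq> \<Union>\<U>"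
  define bad where "bad z \<longleftrightarrow> z \<in> fpaths M \<and> \<not> (\<exists>\<F>. finite \<F> \<and> \<F> \<subseteq> \<U> \<and> cylinder M z \<subseteq> \<Union>\<F>)" for z
  have step: "\<exists>e. e \<in> edges M \<and> erange e = psource z \<and> bad (snoc_path z e)" if z: "bad z" for z
  proof (rule ccontr)
    assume *: "\<not> ?thesis"
    let ?E = "{e \<in> edges M. erange e = psource z}"
    have zw: "z \<in> fpaths M"
      using z by (simp add: bad_def)
    have "snoc_path z e \<in> fpaths M" if "e \<in> ?E" for e
      using that walk_fpath [OF zw] by (auto simp: snoc_path_def FPath_fpaths_iff walk_append)
    then have "\<forall>e \<in> ?E. \<exists>\<F>. finite \<F> \<and> \<F> \<subseteq> \<U> \<and> cylinder M (snoc_path z e) \<subseteq> \<Union>\<F>"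
      using * unfolding bad_def by blast
    then obtain F where F: "\<And>e. e \<in> ?E \<Longrightarrow> finite (F e) \<and> F e \<subseteq> \<U> \<and> cylinder M (snoc_path z e) \<subseteq> \<Union>(F e)"
      by metis
    have "finite (\<Union>(F ` ?E))"
      using F edges_finite [of M] by auto
    moreover have "\<Union>(F ` ?E) \<subseteq> \<U>"
      using F by blast
    moreover have "cylinder M z \<subseteq> \<Union>(\<Union>(F ` ?E))"
    proof
      fix w assume "w \<in> cylinder M z"
      then obtain e where e: "e \<in> ?E" "w \<in> cylinder M (snoc_path z e)"
        using cylinder_snoc [OF zw] by (metis (mono_tags, lifting) mem_Collect_eq)
      then have "w \<in> \<Union>(F e)"
        using F [OF e(1)] by (meson subsetD)
      then show "w \<in> \<Union>(\<Union>(F ` ?E))"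
        using e(1) by (meson UN_I UnionE UnionI)
    qed
    ultimately show False
      using z unfolding bad_def by blast
  qed
  show "\<exists>\<F>. finite \<F> \<and> \<F> \<subseteq> \<U> \<and> cylinder M x \<subseteq> \<Union>\<F>"
  proof (rule ccontr)
    assume "\<not> ?thesis"
    then have "bad x"
      using assms by (simp add: bad_def)
    obtain nxt where nxt: "\<And>z. bad z \<Longrightarrow> nxt z \<in> edges M \<and> erange (nxt z) = psource z \<and> bad (snoc_path z (nxt z))"
      using step by metis
    define X where "X = rec_nat x (\<lambda>_ z. snoc_path z (nxt z))"
    define y where "y i = nxt (X i)" for i
    have X_simps: "X 0 = x" "X (Suc i) = snoc_path (X i) (y i)" for i
      by (simp_all add: X_def y_def)
    have badX: "bad (X i)" for i
      using \<open>bad x\<close> nxt by (induction i) (simp_all add: X_simps(1), simp add: X_def)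
    have X: "X i = FPath (prange x) (pedges x @ initial i y)" for i
      by (induction i) (simp_all add: X_simps snoc_path_def)
    have y_edge: "y i \<in> edges M" "erange (y i) = psource (X i)" for i
      using nxt [OF badX] by (simp_all add: y_def)
    have "psource (X (Suc i)) = esource (y i)" for i
      by (simp add: X_simps snoc_path_def psource_def)
    then have y: "y \<in> ipaths M"
      using y_edge by (simp add: ipaths_def)
    have y0: "erange (y 0) = psource x"
      using y_edge(2) [of 0] by (simp add: X_simps)
    let ?w = "pedges x \<frown> y"
    have w: "?w \<in> ipaths M" "erange (?w 0) = prange x"
      using conc_ipaths walk_fpath [OF assms] y y0 by metis+
    then have "?w \<in> cylinder M x"
      using assms by (simp add: cylinder_iff ptake_def)
    then obtain U where U: "U \<in> \<U>" "?w \<in> U"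
      using \<U> by blast
    then obtain n where n: "cylinder M (ptake n ?w) \<subseteq> U"
      using \<U> openin_ipath_topology by metis
    let ?m = "length (pedges x) + n"
    have "ptake ?m ?w = X n"
      using w by (simp add: ptake_def X)
    moreover have "cylinder M (ptake ?m ?w) \<subseteq> cylinder M (ptake n ?w)"
      by (rule cylinder_mono [OF w(1)]) simp
    ultimately have "cylinder M (X n) \<subseteq> \<Union>{U}"
      using n by auto
    then show False
      using badX [of n] U(1) unfolding bad_def by blast
  qed
qed

section \<open>The topology of the groupoid of germs\<close>

context katsura
begin

abbreviation "\<G> \<equiv> KEP_groupoid A B"

lemma germ_pairs_ipaths: "(s, w) \<in> germ_pairs A B \<Longrightarrow> w \<in> ipaths A"
  by (auto elim: germ_pairs_class)

lemma topspace_pairs: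
  "topspace (subtopology (prod_topology (discrete_topology (S_carrier A B)) (ipath_topology A)) (germ_pairs A B)) =
     germ_pairs A B"
proof -
  have "germ_pairs A B \<subseteq> S_carrier A B \<times> ipaths A"
    by (auto simp: S_carrier_def elim: germ_pairs_class)
  then show ?thesis
    by auto
qed

lemma topspace_groupoid: "topspace (gtop \<G>) = germ A B ` germ_pairs A B"
  by (simp add: KEP_groupoid_def topspace_quotient_topology topspace_pairs del: topspace_subtopology)

lemma openin_groupoid:
  "openin (gtop \<G>) V \<longleftrightarrow> V \<subseteq> germ A B ` germ_pairs A B \<and>
     (\<forall>s w. (s, w) \<in> germ_pairs A B \<longrightarrow> germ A B (s, w) \<in> V \<longrightarrow>
        (\<exists>n. \<forall>w' \<in> cylinder A (ptake n w). (s, w') \<in> germ_pairs A B \<longrightarrow> germ A B (s, w') \<in> V))"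
proof -
  let ?X = "prod_topology (discrete_topology (S_carrier A B)) (ipath_topology A)"
  let ?gp = "germ_pairs A B"
  let ?P = "{x \<in> ?gp. germ A B x \<in> V}"
  have "openin (subtopology ?X ?gp) ?P \<longleftrightarrow> (\<forall>s w. (s, w) \<in> ?P \<longrightarrow>
      (\<exists>n. \<forall>w' \<in> cylinder A (ptake n w). (s, w') \<in> ?gp \<longrightarrow> germ A B (s, w') \<in> V))" (is "?L \<longleftrightarrow> ?R")
  proof
    assume ?L
    then obtain T where T: "openin ?X T" "?P = T \<inter> ?gp"
      by (auto simp: openin_subtopology)
    show ?R
    proof (intro allI impI)
      fix s w assume sw: "(s, w) \<in> ?P"
      then have "(s, w) \<in> T"
        using T(2) by blast
      then obtain U W where UW: "openin (ipath_topology A) W" "s \<in> U" "w \<in> W" "U \<times> W \<subseteq> T"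
        using T(1) openin_prod_topology_alt by metis
      then obtain n where n: "cylinder A (ptake n w) \<subseteq> W"
        using openin_ipath_topology by metis
      have "germ A B (s, w') \<in> V" if "w' \<in> cylinder A (ptake n w)" "(s, w') \<in> ?gp" for w'
      proof -
        have "(s, w') \<in> T \<inter> ?gp"
          using that n UW by blast
        then show ?thesis
          using T(2) by blast
      qed
      then show "\<exists>n. \<forall>w' \<in> cylinder A (ptake n w). (s, w') \<in> ?gp \<longrightarrow> germ A B (s, w') \<in> V"
        by blast
    qed
  next
    assume R: ?R
    show ?L
    proof (subst openin_subopen, intro ballI)
      fix z assume "z \<in> ?P"
      then obtain s w where z: "z = (s, w)" and sw: "(s, w) \<in> ?P"
        by (cases z) blast
      then obtain n where n: "\<forall>w' \<in> cylinder A (ptake n w). (s, w') \<in> ?gp \<longrightarrow> germ A B (s, w') \<in> V"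
        using R by blast
      have "(s, w) \<in> ?gp"
        using sw by blast
      then have w: "w \<in> ipaths A" and s: "s \<in> S_carrier A B"
        by (auto simp: S_carrier_def elim: germ_pairs_class)
      let ?T = "({s} \<times> cylinder A (ptake n w)) \<inter> ?gp"
      have "openin ?X ({s} \<times> cylinder A (ptake n w))"
        using s w by (simp add: openin_prod_Times_iff openin_cylinder ptake_fpaths)
      then have "openin (subtopology ?X ?gp) ?T"
        by (auto simp: openin_subtopology)
      moreover have "z \<in> ?T" "?T \<subseteq> ?P"
        using z sw n ptake_cylinder [OF w] by auto
      ultimately show "\<exists>T. openin (subtopology ?X ?gp) T \<and> z \<in> T \<and> T \<subseteq> ?P"
        by blast
    qed
  qed
  then show ?thesis
    by (simp add: KEP_groupoid_def openin_quotient_topology topspace_pairs imp_conjL del: topspace_subtopology)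
qed

lemma gsource_germ: "(s, w) \<in> germ_pairs A B \<Longrightarrow> gsource \<G> (germ A B (s, w)) = w"
  by (auto simp: KEP_groupoid_def germ_eq)

lemma grange_germ:
  assumes "(s, w) \<in> germ_pairs A B"
  shows "grange \<G> (germ A B (s, w)) = S_app A B s w"
proof -
  have "(s, w) \<in> germ A B (s, w)"
    using assms by (auto simp: germ_eq)
  moreover have "S_app A B t w' = S_app A B s w" if "(t, w') \<in> germ A B (s, w)" for t w'
  proof -
    have "w' = w" "(t, w) \<in> germ_pairs A B" "\<exists>n. restr s w n = restr t w n"
      using that unfolding germ_eq [OF assms] by blast+
    then show ?thesis
      using restr_S_app [OF assms] by metis
  qed
  ultimately have "(THE z. \<exists>t w'. (t, w') \<in> germ A B (s, w) \<and> z = S_app A B t w') = S_app A B s w"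
    by (intro the_equality) blast+
  then show ?thesis
    by (simp add: KEP_groupoid_def)
qed

lemma S_app_inj:
  assumes "(s, w) \<in> germ_pairs A B" "(s, w') \<in> germ_pairs A B" "S_app A B s w = S_app A B s w'"
  shows "w = w'"
proof -
  obtain x where x: "x \<in> gen_words A" "s = S_class A B x"
    using assms(1) by (rule germ_pairs_class)
  have "(Inf w, Inf (S_app A B s w)) \<in> elem_rel s" "(Inf w', Inf (S_app A B s w)) \<in> elem_rel s"
    using S_app_elem_rel [OF assms(1)] S_app_elem_rel [OF assms(2)] assms(3) by simp_all
  then show ?thesis
    using elem_rel_single_valued(2) x by blast
qed

definition slice :: "'n gen list set \<Rightarrow> 'n fpath \<Rightarrow> ('n gen list set \<times> 'n edge word) set set" where
  "slice s x = (\<lambda>w. germ A B (s, w)) ` cylinder A x"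

text \<open>Equality of the germs of \<open>s\<close> and \<open>t\<close> at \<open>w\<close> is witnessed by a prefix of \<open>w\<close>, hence persists for all
  paths in its cylinder; this gives openness. Compactness is inherited from the cylinder.\<close>

lemma slice_bisection:
  assumes x: "x \<in> fpaths A" and gp: "\<And>w. w \<in> cylinder A x \<Longrightarrow> (s, w) \<in> germ_pairs A B"
  shows "compact_open_bisection \<G> (slice s x)"
proof -
  have op: "openin (gtop \<G>) (slice s x)"
    unfolding openin_groupoid
  proof (intro conjI allI impI)
    show "slice s x \<subseteq> germ A B ` germ_pairs A B"
      using gp by (auto simp: slice_def)
    fix t w assume t: "(t, w) \<in> germ_pairs A B" "germ A B (t, w) \<in> slice s x"
    then obtain w0 where w0: "w0 \<in> cylinder A x" "germ A B (t, w) = germ A B (s, w0)"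
      by (auto simp: slice_def)
    then have w: "w \<in> cylinder A x" and "\<exists>n. restr t w n = restr s w n"
      using germ_eq_iff [OF t(1) gp [OF w0(1)]] by auto
    then obtain n where n: "restr t w n = restr s w n"
      by blast
    have wi: "w \<in> ipaths A" "ptake (length (pedges x)) w = x"
      using w x by (auto simp: cylinder_iff)
    let ?N = "max n (length (pedges x))"
    have "germ A B (t, w') \<in> slice s x"
      if w': "w' \<in> cylinder A (ptake ?N w)" "(t, w') \<in> germ_pairs A B" for w'
    proof -
      have eq: "w' \<in> ipaths A" "ptake ?N w' = ptake ?N w"
        using w' wi by (auto simp: cylinder_ptake_iff)
      have "ptake (length (pedges x)) w' = x" "ptake n w' = ptake n w"
        using ptake_mono [OF eq(2), of "length (pedges x)"] ptake_mono [OF eq(2), of n] wi(2) by simp_all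
      then have "w' \<in> cylinder A x" "restr t w' n = restr s w' n"
        using eq x n by (simp_all add: cylinder_iff restr_def)
      then have "germ A B (t, w') = germ A B (s, w')"
        using germ_eq_iff [OF w'(2) gp] by blast
      then show ?thesis
        using \<open>w' \<in> cylinder A x\<close> by (simp add: slice_def)
    qed
    then show "\<exists>n. \<forall>w' \<in> cylinder A (ptake n w). (t, w') \<in> germ_pairs A B \<longrightarrow> germ A B (t, w') \<in> slice s x"
      by blast
  qed
  let ?C = "cylinder A x"
  have "continuous_map (subtopology (ipath_topology A) ?C) (gtop \<G>) (\<lambda>w. germ A B (s, w))"
    unfolding continuous_map
  proof (intro conjI allI impI)
    show "(\<lambda>w. germ A B (s, w)) ` topspace (subtopology (ipath_topology A) ?C) \<subseteq> topspace (gtop \<G>)"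
      using gp by (auto simp: topspace_groupoid)
    fix V assume V: "openin (gtop \<G>) V"
    have top: "topspace (subtopology (ipath_topology A) ?C) = ?C"
      using x cylinder_subset_ipaths by auto
    have "\<exists>n. cylinder A (ptake n w) \<subseteq> {w \<in> ?C. germ A B (s, w) \<in> V}"
      if w: "w \<in> ?C" "germ A B (s, w) \<in> V" for w
    proof -
      obtain n where n: "\<forall>w' \<in> cylinder A (ptake n w). (s, w') \<in> germ_pairs A B \<longrightarrow> germ A B (s, w') \<in> V"
        using V w gp openin_groupoid by meson
      have wi: "w \<in> ipaths A" "ptake (length (pedges x)) w = x"
        using w x by (auto simp: cylinder_iff)
      let ?N = "max n (length (pedges x))"
      have "cylinder A (ptake ?N w) \<subseteq> ?C" "cylinder A (ptake ?N w) \<subseteq> cylinder A (ptake n w)"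
        using cylinder_mono [OF wi(1), of "length (pedges x)" ?N] cylinder_mono [OF wi(1), of n ?N] wi(2) by simp_all
      then show ?thesis
        using n gp by blast
    qed
    then have "openin (ipath_topology A) {w \<in> ?C. germ A B (s, w) \<in> V}"
      using cylinder_subset_ipaths [OF x] unfolding openin_ipath_topology by blast
    then show "openin (subtopology (ipath_topology A) ?C)
        {w \<in> topspace (subtopology (ipath_topology A) ?C). germ A B (s, w) \<in> V}"
      unfolding top using openin_open_subtopology [OF openin_cylinder [OF x]] by auto
  qed
  moreover have "compactin (subtopology (ipath_topology A) ?C) ?C"
    by (simp add: compactin_subtopology compactin_cylinder x)
  ultimately have "compactin (gtop \<G>) (slice s x)"
    unfolding slice_def by (rule image_compactin [rotated])
  moreover have "inj_on (gsource \<G>) (slice s x)" "inj_on (grange \<G>) (slice s x)"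
    using gp S_app_inj [OF gp gp]
    by (auto simp: slice_def gsource_germ grange_germ inj_on_def dest!: S_app_inj [OF gp gp, rotated 2])
  ultimately show ?thesis
    using op by (simp add: compact_open_bisection_def)
qed

lemma continuous_gsource: "continuous_map (gtop \<G>) (ipath_topology A) (gsource \<G>)"
  unfolding continuous_map
proof (intro conjI allI impI)
  show "gsource \<G> ` topspace (gtop \<G>) \<subseteq> topspace (ipath_topology A)"
    using germ_pairs_ipaths by (auto simp: topspace_groupoid gsource_germ)
  fix D assume D: "openin (ipath_topology A) D"
  show "openin (gtop \<G>) {\<gamma> \<in> topspace (gtop \<G>). gsource \<G> \<gamma> \<in> D}"
    unfolding openin_groupoid
  proof (intro conjI allI impI)
    fix s w assume sw: "(s, w) \<in> germ_pairs A B" "germ A B (s, w) \<in> {\<gamma> \<in> topspace (gtop \<G>). gsource \<G> \<gamma> \<in> D}"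
    then have "w \<in> D"
      by (simp add: gsource_germ)
    then obtain n where n: "cylinder A (ptake n w) \<subseteq> D"
      using D openin_ipath_topology by metis
    then have "germ A B (s, w') \<in> {\<gamma> \<in> topspace (gtop \<G>). gsource \<G> \<gamma> \<in> D}"
      if "w' \<in> cylinder A (ptake n w)" "(s, w') \<in> germ_pairs A B" for w'
      using that by (auto simp: gsource_germ topspace_groupoid)
    then show "\<exists>n. \<forall>w' \<in> cylinder A (ptake n w). (s, w') \<in> germ_pairs A B \<longrightarrow>
        germ A B (s, w') \<in> {\<gamma> \<in> topspace (gtop \<G>). gsource \<G> \<gamma> \<in> D}"
      by blast
  qed (auto simp: topspace_groupoid)
qed

text \<open>If \<open>U\<close> contains a germ over \<open>w\<close>, then by openness it contains the neighbouring germs of the same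
  semigroup element and, being a bisection, no others. If not, then the source of \<open>U\<close>, which is compact and hence
  closed, misses a neighbourhood of \<open>w\<close>. In this way elements of the Steinberg algebra can be described
  over a small cylinder without decomposing \<open>U\<close> into basic bisections globally.\<close>

lemma bisection_local_form:
  assumes U: "compact_open_bisection \<G> U" and w: "w \<in> ipaths A"
  shows "\<exists>N. \<forall>n\<ge>N. (\<forall>\<gamma> \<in> U. gsource \<G> \<gamma> \<notin> cylinder A (ptake n w)) \<or>
    (\<exists>p k. p \<in> fpaths A \<and> psource p = psource (ptake n w) \<and>
      (\<forall>w' \<in> cylinder A (ptake n w). \<forall>\<gamma>. \<gamma> \<in> topspace (gtop \<G>) \<and> gsource \<G> \<gamma> = w' \<longrightarrow>
        (\<gamma> \<in> U \<longleftrightarrow> \<gamma> = germ A B (S_elem A B p k (ptake n w), w'))))"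
proof (cases "w \<in> gsource \<G> ` U")
  case True
  have op: "openin (gtop \<G>) U" and inj: "inj_on (gsource \<G>) U"
    using U by (auto simp: compact_open_bisection_def)
  obtain \<gamma>0 where "\<gamma>0 \<in> U" "gsource \<G> \<gamma>0 = w"
    using True by blast
  then obtain s where s: "(s, w) \<in> germ_pairs A B" "germ A B (s, w) \<in> U"
    using openin_subset [OF op] by (auto simp: topspace_groupoid gsource_germ)
  obtain n0 where n0: "\<forall>w' \<in> cylinder A (ptake n0 w). (s, w') \<in> germ_pairs A B \<longrightarrow> germ A B (s, w') \<in> U"
    using op s openin_groupoid by meson
  obtain N where N: "\<And>n. n \<ge> N \<Longrightarrow> \<exists>p k. p \<in> fpaths A \<and> psource p = psource (ptake n w) \<and>
    (\<forall>w' \<in> cylinder A (ptake n w). (s, w') \<in> germ_pairs A B \<and>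
       germ A B (s, w') = germ A B (S_elem A B p k (ptake n w), w'))"
    using germ_normal_form [OF s(1)] by blast
  show ?thesis
  proof (intro exI [of _ "max n0 N"] allI impI disjI2)
    fix n assume n: "max n0 N \<le> n"
    then obtain p k where p: "p \<in> fpaths A" "psource p = psource (ptake n w)"
      and pk: "\<And>w'. w' \<in> cylinder A (ptake n w) \<Longrightarrow> (s, w') \<in> germ_pairs A B \<and>
       germ A B (s, w') = germ A B (S_elem A B p k (ptake n w), w')"
      using N [of n] by auto
    have "\<gamma> \<in> U \<longleftrightarrow> \<gamma> = germ A B (S_elem A B p k (ptake n w), w')"
      if w': "w' \<in> cylinder A (ptake n w)" and \<gamma>: "gsource \<G> \<gamma> = w'" for w' \<gamma>
    proof -
      have gp: "(s, w') \<in> germ_pairs A B"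
        using pk w' by blast
      have "w' \<in> cylinder A (ptake n0 w)"
        using cylinder_mono [OF w, of n0 n] n w' by auto
      then have "germ A B (s, w') \<in> U"
        using n0 gp by blast
      moreover have "gsource \<G> (germ A B (s, w')) = w'"
        using gp by (rule gsource_germ)
      ultimately have "\<gamma> \<in> U \<longleftrightarrow> \<gamma> = germ A B (s, w')"
        using inj \<gamma> by (auto dest: inj_onD)
      then show ?thesis
        using pk w' by simp
    qed
    then show "\<exists>p k. p \<in> fpaths A \<and> psource p = psource (ptake n w) \<and>
      (\<forall>w' \<in> cylinder A (ptake n w). \<forall>\<gamma>. \<gamma> \<in> topspace (gtop \<G>) \<and> gsource \<G> \<gamma> = w' \<longrightarrow>
        (\<gamma> \<in> U \<longleftrightarrow> \<gamma> = germ A B (S_elem A B p k (ptake n w), w')))"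
      using p by blast
  qed
next
  case False
  have "compactin (ipath_topology A) (gsource \<G> ` U)"
    using U continuous_gsource by (auto simp: compact_open_bisection_def intro: image_compactin)
  then have "closedin (ipath_topology A) (gsource \<G> ` U)"
    by (rule compactin_imp_closedin [OF Hausdorff_ipath_topology])
  then have "openin (ipath_topology A) (ipaths A - gsource \<G> ` U)"
    by (simp add: closedin_def)
  then obtain N where N: "cylinder A (ptake N w) \<subseteq> ipaths A - gsource \<G> ` U"
    using w False openin_ipath_topology by (metis DiffI)
  have "\<forall>\<gamma> \<in> U. gsource \<G> \<gamma> \<notin> cylinder A (ptake n w)" if "n \<ge> N" for n
    using N cylinder_mono [OF w that] by blast
  then show ?thesis
    by blast
qed

section \<open>The singular ideal\<close>

lemma ipath_from_vertex:
  obtains y where "y \<in> ipaths A" "erange (y 0) = v"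
proof -
  have "\<exists>e. e \<in> edges A \<and> erange e = u" for u
  proof -
    obtain w where "A $ u $ w \<noteq> 0"
      using pair unfolding katsura_pair_def by blast
    moreover have "0 \<le> A $ u $ w"
      using pair by (simp add: katsura_pair_def)
    ultimately show ?thesis
      by (intro exI [of _ "Edge u w 0"]) (simp add: edges_def)
  qed
  then obtain nxt where nxt: "\<And>u. nxt u \<in> edges A" "\<And>u. erange (nxt u) = u"
    by metis
  let ?y = "\<lambda>i. nxt (((\<lambda>u. esource (nxt u)) ^^ i) v)"
  show ?thesis
    using that [of ?y] nxt by (simp add: ipaths_def)
qed

lemma cylinder_nonempty:
  assumes "x \<in> fpaths A"
  obtains w where "w \<in> cylinder A x"
  using ipath_from_vertex [of "psource x"] cylinder_conc [OF assms] by metis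

lemma steinberg_carrier_iff:
  "f \<in> carrier (steinberg_algebra G) \<longleftrightarrow> (\<exists>F a. finite F \<and> (\<forall>U\<in>F. compact_open_bisection G U) \<and>
     f = (\<lambda>c. \<Sum>U\<in>F. a U * indicator U c))"
  by (simp add: steinberg_algebra_def)

lemma singular_open_zero:
  assumes "f \<in> singular_ideal G" "openin (gtop G) V" "V \<noteq> {}"
  obtains \<gamma> where "\<gamma> \<in> V" "f \<gamma> = 0"
proof -
  have "\<not> V \<subseteq> {c. f c \<noteq> 0}"
    using assms interior_of_maximal [of V "{c. f c \<noteq> 0}" "gtop G"] by (auto simp: singular_ideal_def)
  then show ?thesis
    using that by blast
qed

text \<open>Let \<open>w\<^sub>0\<close> be the source of \<open>\<gamma>\<^sub>0\<close> and \<open>x\<close> a long prefix of \<open>w\<^sub>0\<close>. Over the cylinder of \<open>x\<close>, each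
  bisection in \<open>f\<close> is empty or consists of the germs of one element \<open>p g\<^sup>k x\<^sup>*\<close>. Only those with the same
  \<open>p = p\<^sub>0\<close> as \<open>\<gamma>\<^sub>0\<close> matter, because germs with different \<open>p\<close> are different, and collecting the
  coefficients by exponent turns \<open>f\<close> into a class sum.\<close>

lemma vertex_of_singular_element:
  fixes f :: "('n gen list set \<times> 'n edge word) set \<Rightarrow> 'k::field"
  assumes f: "f \<in> singular_ideal \<G>" and "f \<gamma>0 \<noteq> 0"
  obtains v :: 'n and D and b :: "int \<Rightarrow> 'k" and y0 k0 where "finite D"
    "y0 \<in> ipaths A" "erange (y0 0) = v" "class_sum D b k0 y0 \<noteq> 0"
    "\<And>k es u. walk A v es u \<Longrightarrow>
       \<exists>y. y \<in> ipaths A \<and> erange (y 0) = v \<and> initial (length es) y = es \<and> class_sum D b k y = 0"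
proof -
  obtain F a where F: "finite F" "\<And>U. U \<in> F \<Longrightarrow> compact_open_bisection \<G> U"
      and f_eq: "f = (\<lambda>c. \<Sum>U\<in>F. a U * indicator U c)"
    using f by (auto simp: singular_ideal_def steinberg_carrier_iff)
  obtain U0 where "U0 \<in> F" "\<gamma>0 \<in> U0"
  proof (rule ccontr)
    assume "\<not> thesis"
    then have "f \<gamma>0 = 0"
      using that unfolding f_eq by (intro sum.neutral) (auto simp: indicator_def)
    then show False
      using assms(2) by simp
  qed
  then have "\<gamma>0 \<in> topspace (gtop \<G>)"
    using F(2) openin_subset by (auto simp: compact_open_bisection_def)
  then obtain s0 w0 where sw: "(s0, w0) \<in> germ_pairs A B" and \<gamma>0: "\<gamma>0 = germ A B (s0, w0)"
    by (auto simp: topspace_groupoid)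
  have w0: "w0 \<in> ipaths A"
    using sw by (rule germ_pairs_ipaths)
  define misses where "misses n U \<longleftrightarrow> (\<forall>\<gamma> \<in> U. gsource \<G> \<gamma> \<notin> cylinder A (ptake n w0))" for n U
  define is_slice where "is_slice n U p k \<longleftrightarrow> p \<in> fpaths A \<and> psource p = psource (ptake n w0) \<and>
      (\<forall>w' \<in> cylinder A (ptake n w0). \<forall>\<gamma>. \<gamma> \<in> topspace (gtop \<G>) \<and> gsource \<G> \<gamma> = w' \<longrightarrow>
        (\<gamma> \<in> U \<longleftrightarrow> \<gamma> = germ A B (S_elem A B p k (ptake n w0), w')))" for n U p k
  have "\<forall>U \<in> F. \<exists>N. \<forall>n\<ge>N. misses n U \<or> (\<exists>p k. is_slice n U p k)"
    unfolding misses_def is_slice_def using bisection_local_form [OF F(2) w0] by blast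
  then obtain N where N: "\<And>U n. U \<in> F \<Longrightarrow> N U \<le> n \<Longrightarrow> misses n U \<or> (\<exists>p k. is_slice n U p k)"
    by metis
  obtain N0 where N0: "\<And>n. n \<ge> N0 \<Longrightarrow> \<exists>p k. p \<in> fpaths A \<and> psource p = psource (ptake n w0) \<and>
    (\<forall>w' \<in> cylinder A (ptake n w0). (s0, w') \<in> germ_pairs A B \<and>
       germ A B (s0, w') = germ A B (S_elem A B p k (ptake n w0), w'))"
    using germ_normal_form [OF sw] by blast
  define n where "n = N0 + (\<Sum>U\<in>F. N U)"
  have n_ge: "N U \<le> n" if "U \<in> F" for U
    using member_le_sum [of U F N] F(1) that by (simp add: n_def)
  define x where "x = ptake n w0"
  define v where "v = psource x"
  have x: "x \<in> fpaths A" "w0 \<in> cylinder A x"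
    using ptake_fpaths [OF w0] ptake_cylinder [OF w0] by (simp_all add: x_def)
  obtain p0 k0 where p0: "p0 \<in> fpaths A" "psource p0 = v" and \<gamma>0_eq: "\<gamma>0 = germ A B (S_elem A B p0 k0 x, w0)"
    using N0 [of n] x(2) \<gamma>0 by (auto simp: n_def x_def v_def)
  obtain y0 where y0: "y0 \<in> ipaths A" "erange (y0 0) = v" "w0 = pedges x \<frown> y0"
    using x cylinder_conc v_def by metis
  define F1 where "F1 = {U \<in> F. \<not> misses n U}"
  have "\<forall>U \<in> F1. \<exists>p k. is_slice n U p k"
    unfolding F1_def using N n_ge by blast
  then obtain P K where PK: "\<And>U. U \<in> F1 \<Longrightarrow> is_slice n U (P U) (K U)"
    by metis
  define F2 where "F2 = {U \<in> F1. P U = p0}"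
  have fin: "finite F2"
    using F(1) by (simp add: F2_def F1_def)
  define b where "b l = (\<Sum>U | U \<in> F2 \<and> K U = l. a U)" for l
  define D where "D = K ` F2"
  have f_value: "f (germ A B (S_elem A B p0 k x, pedges x \<frown> y)) = class_sum D b k y"
    if y: "y \<in> ipaths A" "erange (y 0) = v" for k y
  proof -
    let ?w = "pedges x \<frown> y" and ?g = "germ A B (S_elem A B p0 k x, pedges x \<frown> y)"
    have w: "?w \<in> cylinder A x"
      using y x cylinder_conc v_def by blast
    then have gp: "(S_elem A B p0 k x, ?w) \<in> germ_pairs A B"
      using p0 x v_def by (intro elem_germ_pairs) auto
    then have g: "?g \<in> topspace (gtop \<G>)" "gsource \<G> ?g = ?w"
      by (auto simp: topspace_groupoid gsource_germ)
    \<comment> \<open>Bisections that miss the cylinder and those with another path in place of \<open>p\<^sub>0\<close> do not contain the germ.\<close>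
    have mem: "?g \<in> U \<longleftrightarrow> U \<in> F2 \<and> fuse k (K U) y" if U: "U \<in> F" for U
    proof (cases "misses n U")
      case True
      then show ?thesis
        using g(2) w by (auto simp: misses_def F1_def F2_def x_def)
    next
      case False
      then have "U \<in> F1"
        using U by (simp add: F1_def)
      then have "is_slice n U (P U) (K U)"
        by (rule PK)
      then have PU: "P U \<in> fpaths A" "psource (P U) = psource x"
        and gU: "?g \<in> U \<longleftrightarrow> ?g = germ A B (S_elem A B (P U) (K U) x, ?w)"
        using g w unfolding is_slice_def x_def by blast+
      have "?g = germ A B (S_elem A B (P U) (K U) x, ?w) \<longleftrightarrow> p0 = P U \<and> fuse k (K U) y"
        using p0 x y PU v_def by (intro germ_elem_eq_iff) auto
      then show ?thesis
        unfolding gU using \<open>U \<in> F1\<close> by (auto simp: F2_def)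
    qed
    have "f ?g = (\<Sum>U\<in>F. if U \<in> F2 \<and> fuse k (K U) y then a U else 0)"
    proof (unfold f_eq, rule sum.cong [OF HOL.refl])
      fix U assume "U \<in> F"
      then show "a U * indicator U ?g = (if U \<in> F2 \<and> fuse k (K U) y then a U else 0)"
        using mem [of U] by (cases "?g \<in> U") auto
    qed
    also have "\<dots> = (\<Sum>U | U \<in> F2 \<and> fuse k (K U) y. a U)"
      using F(1) by (intro sum.mono_neutral_cong_right) (auto simp: F1_def F2_def)
    also have "\<dots> = (\<Sum>l | l \<in> D \<and> fuse k l y. \<Sum>U | U \<in> {U. U \<in> F2 \<and> fuse k (K U) y} \<and> K U = l. a U)"
      by (rule sum.group [symmetric]) (use fin in \<open>auto simp: D_def\<close>)
    also have "\<dots> = class_sum D b k y"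
      unfolding class_sum_def b_def by (intro sum.cong HOL.refl) auto
    finally show ?thesis .
  qed
  show ?thesis
  proof (rule that [of D y0 v b k0])
    show "finite D"
      using fin by (simp add: D_def)
    show "class_sum D b k0 y0 \<noteq> 0"
      using f_value [OF y0(1,2), of k0] assms(2) \<gamma>0_eq y0(3) by simp
    fix k es u assume es: "walk A v es u"
    let ?e = "FPath v es"
    have e: "?e \<in> fpaths A"
      using es by (auto simp: FPath_fpaths_iff)
    have xe: "papp x ?e \<in> fpaths A"
      using x(1) e v_def by (intro papp_fpath) auto
    have sub: "w \<in> cylinder A x" "initial (length (pedges x) + length es) w = pedges x @ es"
      if w: "w \<in> cylinder A (papp x ?e)" for w
    proof -
      have w': "w \<in> ipaths A" "ptake (length (pedges x) + length es) w = papp x ?e"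
        using w cylinder_iff [OF xe] by (simp_all add: papp_def)
      then show i: "initial (length (pedges x) + length es) w = pedges x @ es"
        by (metis fpath.sel(2) papp_def pedges_ptake)
      have "erange (w 0) = prange x"
        using w'(2) by (metis fpath.sel(1) papp_def prange_ptake)
      moreover have "initial (length (pedges x)) w = pedges x"
        using arg_cong [OF i, of "take (length (pedges x))"] by simp
      ultimately show "w \<in> cylinder A x"
        using w'(1) x(1) by (simp add: cylinder_iff ptake_def)
    qed
    let ?s = "S_elem A B p0 k x"
    have "(?s, w) \<in> germ_pairs A B" if "w \<in> cylinder A (papp x ?e)" for w
      using p0 x v_def sub(1) [OF that] by (intro elem_germ_pairs) auto
    then have "openin (gtop \<G>) (slice ?s (papp x ?e))"
      using slice_bisection [OF xe] by (simp add: compact_open_bisection_def)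
    moreover have "slice ?s (papp x ?e) \<noteq> {}"
      using cylinder_nonempty [OF xe] by (auto simp: slice_def)
    ultimately obtain \<gamma> where "\<gamma> \<in> slice ?s (papp x ?e)" "f \<gamma> = 0"
      using singular_open_zero [OF f] by blast
    then obtain w where w: "w \<in> cylinder A (papp x ?e)" "f (germ A B (?s, w)) = 0"
      by (auto simp: slice_def)
    obtain y where y: "y \<in> ipaths A" "erange (y 0) = v" "w = pedges x \<frown> y"
      using sub(1) [OF w(1)] x(1) cylinder_conc v_def by metis
    have "initial (length es) y = es"
      using sub(2) [OF w(1)] y(3) by simp
    then show "\<exists>y. y \<in> ipaths A \<and> erange (y 0) = v \<and> initial (length es) y = es \<and> class_sum D b k y = 0"
      using f_value [OF y(1,2), of k] w(2) y by auto
  qed (use y0 in auto)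
qed

text \<open>If \<open>g\<^sup>k\<close> acts trivially then it fuses with the unit exactly along the paths that meet weight zero. The
  difference of the indicator functions of their bisections is therefore nonzero along \<open>y\<close>, while its zeros meet
  every open set because each path extends to one of weight zero.\<close>

lemma singular_element_of_vertex:
  assumes k: "k \<noteq> 0" "\<And>p. p \<in> fpaths_from A v \<Longrightarrow> fpath_act A B k p = p"
    and y: "y \<in> ipaths A" "erange (y 0) = v" "\<And>i. nz (y i)"
    and T2: "\<forall>p \<in> fpaths_from A v. \<exists>q \<in> fpaths_from A (psource p). path_weight B (papp p q) = 0"
  obtains f :: "('n gen list set \<times> 'n edge word) set \<Rightarrow> 'k::field" and \<gamma>
  where "f \<in> singular_ideal \<G>" "f \<gamma> \<noteq> 0"
proof -
  let ?v = "FPath v []"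
  define s where "s j = S_elem A B ?v j ?v" for j
  define U where "U j = slice (s j) ?v" for j
  define f :: "('n gen list set \<times> 'n edge word) set \<Rightarrow> 'k" where
    "f \<gamma> = indicator (U 0) \<gamma> - indicator (U k) \<gamma>" for \<gamma>
  have in_cyl: "w \<in> cylinder A ?v \<longleftrightarrow> w \<in> ipaths A \<and> erange (w 0) = v" for w
    by (simp add: cylinder_iff ptake_def)
  have gp: "(s j, w) \<in> germ_pairs A B" if "w \<in> cylinder A ?v" for j w
    using that unfolding s_def by (intro elem_germ_pairs) auto
  have eq_iff: "germ A B (s i, w) = germ A B (s j, w) \<longleftrightarrow> fuse i j w" if "w \<in> cylinder A ?v" for i j w
    using germ_elem_eq_iff [of ?v ?v ?v w i j] that by (simp add: s_def in_cyl)
  have mem: "germ A B (s i, w) \<in> U j \<longleftrightarrow> fuse i j w" if "w \<in> cylinder A ?v" for i j w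
    using that germ_eq_iff [OF gp gp] eq_iff [OF that] unfolding U_def slice_def by (smt (verit) image_iff)
  have bis: "compact_open_bisection \<G> (U j)" for j
    unfolding U_def by (rule slice_bisection) (use gp in auto)
  have "fuse 0 0 y" "\<not> fuse 0 k y"
    using fuse_weight_nonzero [of y] y(3) k(1) by simp_all
  then have g: "germ A B (s 0, y) \<in> U 0" "germ A B (s 0, y) \<notin> U k"
    using mem y in_cyl by simp_all
  then have nonzero: "f (germ A B (s 0, y)) \<noteq> 0"
    by (simp add: f_def)
  have "U 0 \<noteq> U k"
    using g by blast
  then have "f = (\<lambda>c. \<Sum>V\<in>{U 0, U k}. (if V = U 0 then 1 else - 1) * indicator V c)"
    by (intro ext, subst sum.insert) (auto simp: f_def)
  then have "f \<in> carrier (steinberg_algebra \<G>)"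
    unfolding steinberg_carrier_iff using bis
    by (intro exI [of _ "{U 0, U k}"] exI [of _ "\<lambda>V. if V = U 0 then 1 else - 1"]) simp
  moreover have "V = {}" if V: "openin (gtop \<G>) V" "V \<subseteq> {c. f c \<noteq> 0}" for V
  proof (rule ccontr)
    assume "V \<noteq> {}"
    then obtain \<gamma> where \<gamma>: "\<gamma> \<in> V"
      by blast
    then have "\<gamma> \<in> U 0 \<or> \<gamma> \<in> U k"
      using V(2) by (auto simp: f_def indicator_def split: if_splits)
    then obtain j w where j: "j = 0 \<or> j = k" and w: "w \<in> cylinder A ?v" "\<gamma> = germ A B (s j, w)"
      by (auto simp: U_def slice_def)
    obtain n where n: "\<forall>w' \<in> cylinder A (ptake n w). (s j, w') \<in> germ_pairs A B \<longrightarrow> germ A B (s j, w') \<in> V"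
      using V(1) \<gamma> gp [OF w(1), of j] w(2) openin_groupoid by meson
    have wi: "w \<in> ipaths A" "erange (w 0) = v"
      using w(1) in_cyl by auto
    let ?x = "ptake n w"
    have x: "?x \<in> fpaths_from A v"
      using wi ptake_fpaths by (simp add: fpaths_from_def)
    then obtain q where q: "q \<in> fpaths_from A (psource ?x)" "path_weight B (papp ?x q) = 0"
      using T2 by blast
    let ?z = "papp ?x q" and ?m = "length (pedges (papp ?x q))"
    have z: "?z \<in> fpaths A" "prange ?z = v"
      using x q(1) by (auto simp: fpaths_from_def papp_fpath) (simp add: papp_def)
    obtain w' where w': "w' \<in> cylinder A ?z"
      using cylinder_nonempty [OF z(1)] .
    then have w'i: "w' \<in> ipaths A" "ptake ?m w' = ?z"
      using z(1) by (auto simp: cylinder_iff)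
    then have init: "initial ?m w' = pedges ?z" and "erange (w' 0) = v"
      using z(2) by (metis pedges_ptake, metis prange_ptake)
    then have w'v: "w' \<in> cylinder A ?v"
      using in_cyl w'i by blast
    have "initial n w' = initial n w"
      using arg_cong [OF init, of "take n"] by (simp add: papp_def min_absorb1)
    then have "w' \<in> cylinder A ?x"
      unfolding cylinder_ptake_iff [OF wi(1)] using wi w'i(1) \<open>erange (w' 0) = v\<close>
      by (simp add: ptake_def)
    then have "germ A B (s j, w') \<in> V"
      using n gp w'v by blast
    moreover have "f (germ A B (s j, w')) = 0"
    proof -
      have nzz: "\<exists>e \<in> set (pedges ?z). \<not> nz e"
        using q(2) path_weight_nonzero_iff by blast
      have "fpath_act A B k ?z = ?z"
        using k(2) z by (simp add: fpaths_from_def)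
      moreover have "act 0 (pedges ?z) = pedges ?z"
        using act_zero walk_fpath [OF z(1)] by blast
      ultimately have "act i (pedges ?z) = act j (pedges ?z)" if "i \<in> {0, k}" "j \<in> {0, k}" for i j
        using that by (auto simp: fpath_act_fixed_iff)
      then have "fuse i j w'" if "i \<in> {0, k}" "j \<in> {0, k}" for i j
        using fuse_weight_zero [OF w'i(1), of ?m, unfolded init, OF nzz] that by blast
      then have "germ A B (s j, w') \<in> U 0" "germ A B (s j, w') \<in> U k"
        using mem [OF w'v] j by auto
      then show ?thesis
        by (simp add: f_def)
    qed
    ultimately show False
      using V(2) by blast
  qed
  then have "gtop \<G> interior_of {c. f c \<noteq> 0} = {}"
    using interior_of_subset openin_interior_of by metis
  ultimately have "f \<in> singular_ideal \<G>"
    by (simp add: singular_ideal_def)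
  then show ?thesis
    using that nonzero by blast
qed

end

theorem theorem5p7:
  fixes A B :: "int^'n^'n"
  assumes "katsura_pair A B"
  shows "singular_ideal (KEP_groupoid A B) \<noteq>
           {zero (steinberg_algebra (KEP_groupoid A B) ::
              ('k::field, ('n gen list set \<times> 'n edge word) set \<Rightarrow> 'k) module)}
    \<longleftrightarrow>
    (\<exists>v :: 'n. \<not> acts_faithfully A B v \<and>
      (\<exists>r c. r \<in> fpaths_from A v \<and> simple_fpath A r \<and>
         simple_cycle A c \<and> prange c = psource r \<and> psource c = psource r \<and>
         path_weight B (papp r c) \<noteq> 0) \<and>
      (\<forall>p \<in> fpaths_from A v. \<exists>q \<in> fpaths_from A (psource p).
         path_weight B (papp p q) = 0))"
    (is "?J \<noteq> {?zero} \<longleftrightarrow> (\<exists>v. ?nonfaithful v \<and> ?T1 v \<and> ?T2 v)")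
proof -
  interpret katsura A B
    by unfold_locales (rule assms)
  have zero: "?zero = (\<lambda>_. 0)"
    by (simp add: steinberg_algebra_def)
  have "(\<lambda>_. 0) \<in> ?J"
    unfolding singular_ideal_def steinberg_carrier_iff
    by (auto intro!: exI [of _ "{}"])
  then have J: "?J \<noteq> {?zero} \<longleftrightarrow> (\<exists>f \<in> ?J. \<exists>\<gamma>. f \<gamma> \<noteq> 0)"
    unfolding zero by (auto simp: fun_eq_iff)
  show ?thesis
    unfolding J
  proof
    assume "\<exists>f \<in> ?J. \<exists>\<gamma>. f \<gamma> \<noteq> 0"
    then obtain f :: "('n gen list set \<times> 'n edge word) set \<Rightarrow> 'k" and \<gamma>
      where "f \<in> ?J" "f \<gamma> \<noteq> 0"
      by blast
    then obtain v D and b :: "int \<Rightarrow> 'k" and y0 k0 where D: "finite D"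
      and y0: "y0 \<in> ipaths A" "erange (y0 0) = v" and sum: "class_sum D b k0 y0 \<noteq> 0"
        "\<And>k es u. walk A v es u \<Longrightarrow>
          \<exists>y. y \<in> ipaths A \<and> erange (y 0) = v \<and> initial (length es) y = es \<and> class_sum D b k y = 0"
      by (rule vertex_of_singular_element) blast
    have nz: "nz (y0 i)" for i
      by (rule class_sum_vanishing(2) [OF D y0 sum(1)]) (rule sum(2))
    obtain r c where "r \<in> fpaths_from A v" "simple_fpath A r" "simple_cycle A c"
        "prange c = psource r" "path_weight B (papp r c) \<noteq> 0"
      using simple_cycle_of_nonzero_ipath [OF y0 nz] .
    then have "?T1 v"
      by (metis is_cycle_def simple_cycle_def)
    moreover have "?T2 v"
      by (rule class_sum_vanishing(1) [OF D y0 sum(1)]) (rule sum(2))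
    moreover have "?nonfaithful v"
      by (rule class_sum_vanishing(3) [OF D y0 sum(1)]) (rule sum(2))
    ultimately show "\<exists>v. ?nonfaithful v \<and> ?T1 v \<and> ?T2 v"
      by blast
  next
    assume "\<exists>v. ?nonfaithful v \<and> ?T1 v \<and> ?T2 v"
    then obtain v r c where "?nonfaithful v" and T2: "?T2 v"
      and r: "r \<in> fpaths_from A v" "simple_cycle A c" "prange c = psource r" "path_weight B (papp r c) \<noteq> 0"
      by blast
    then obtain k where k: "k \<noteq> 0" "\<And>p. p \<in> fpaths_from A v \<Longrightarrow> fpath_act A B k p = p"
      unfolding acts_faithfully_def by blast
    have "is_cycle A c"
      using r(2) by (simp add: simple_cycle_def)
    then obtain y where y: "y \<in> ipaths A" "erange (y 0) = v" "\<And>i. nz (y i)"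
      using nonzero_ipath_of_cycle r by blast
    obtain f :: "('n gen list set \<times> 'n edge word) set \<Rightarrow> 'k" and \<gamma> where "f \<in> ?J" "f \<gamma> \<noteq> 0"
      using singular_element_of_vertex [OF k y T2] .
    then show "\<exists>f \<in> ?J. \<exists>\<gamma>. f \<gamma> \<noteq> 0"
      by blast
  qed
qed

end
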